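(* Let $(W,S)$ be a finite Coxeter system realized in $V$, with longest element $w_0$, and let $T>0$. For each dominant path $\pi\in C_T^0(V)$ there is an action $\{S_w,\ w\in W\}$ of the Coxeter group $W$ on the set $L_\pi$ such that $S_{s_\alpha}=S_\alpha$ for every simple root $\alpha$, where $S_\alpha\eta=\mathcal E_\alpha^{x}\eta$ with $x=-\alpha^\vee(\eta(T))$.
   Context: **Realization.** $V$ is a finite-dimensional real vector space with dual $V^\vee$, on which the finite Coxeter group $W$ (generated by the finite set of involutions $S$) acts so that $s(x)=x-\alpha_s^\vee(x)\alpha_s$ for $s\in S$, where $(\alpha_s,\alpha_s^\vee)\in V\times V^\vee$, $\alpha_s^\vee(\alpha_s)=2$. With $m(s,s')$ the order of $ss'$, as is standard, for $s\neq s'$: $\alpha_s^\vee(\alpha_{s'})=\alpha_{s'}^\vee(\alpha_s)=0$ if $m(s,s')=2$, otherwise both are negative with product $4\cos^2(\pi/m(s,s'))$. The simple roots are the $\alpha_s$; for $\alpha=\alpha_s$, $\alpha^\vee=\alpha_s^\vee$ and $s_\alpha=s$. $\overline C=\{v\in V:\alpha_s^\vee(v)\ge0\ \forall s\}$. **Paths.** $C_T^0(V)$ is the set of continuous paths $\eta:[0,T]\to V$ with $\eta(0)=0$; a path is dominant if it takes values in $\overline C$. For a simple root $\alpha$, $\mathcal P_\alpha\eta(t)=\eta(t)-\inf_{0\le s\le t}\alpha^\vee(\eta(s))\,\alpha$. For a reduced decomposition $w_0=s_1\cdots s_q$, $\mathcal P_{w_0}=\mathcal P_{\alpha_{s_1}}\cdots\mathcal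 P_{\alpha_{s_q}}$ (independent of the decomposition). For $\pi$ dominant, $L_\pi=\{\eta\in C_T^0(V):\mathcal P_{w_0}\eta=\pi\}$. **Littelmann operators.** For $\eta\in C_T^0(V)$ and $-\alpha^\vee(\eta(T))+\inf_{0\le t\le T}\alpha^\vee(\eta(t))\le x\le-\inf_{0\le t\le T}\alpha^\vee(\eta(t))$, $\mathcal E_\alpha^x\eta$ is the unique path in $C_T^0(V)$ with $\mathcal P_\alpha\mathcal E_\alpha^x\eta=\mathcal P_\alpha\eta$ and $\mathcal E_\alpha^x\eta(T)=\eta(T)+x\alpha$. (The value $x=-\alpha^\vee(\eta(T))$ always lies in this range.) *)

theory Defs
  imports
    "HOL-Analysis.Analysis"
    "HOL-Algebra.Group_Action"
    "HOL-Algebra.Generated_Groups"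
    "HOL-Algebra.Multiplicative_Group"
begin

section \<open>Coxeter systems\<close>

text \<open>Words in the generators are lists; the word \<open>[s1, ..., sq]\<close> stands for the
  product \<open>s1 ... sq\<close>.\<close>

definition word_prod :: "('g, 'b) monoid_scheme \<Rightarrow> 'g list \<Rightarrow> 'g" where
  "word_prod W us = foldr (mult W) us (one W)"

text \<open>The congruence on words generated by the relations \<open>(s t)^m(s,t) = 1\<close>, where
  \<open>m(s,t)\<close> is the order of \<open>s t\<close> in \<open>W\<close>. For \<open>s = t\<close> the relation is \<open>s s = 1\<close>, so formal
  inverses of the generators are not needed. If \<open>s t\<close> has infinite order then
  \<open>group.ord\<close> is 0 and the relation is void.\<close>

inductive coxeter_cong :: "('g, 'b) monoid_scheme \<Rightarrow> 'g set \<Rightarrow> 'g list \<Rightarrow> 'g list \<Rightarrow> bool"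
  for W S where
  refl: "us \<in> lists S \<Longrightarrow> coxeter_cong W S us us"
| sym: "coxeter_cong W S us vs \<Longrightarrow> coxeter_cong W S vs us"
| trans: "coxeter_cong W S us vs \<Longrightarrow> coxeter_cong W S vs ws \<Longrightarrow> coxeter_cong W S us ws"
| rel: "us \<in> lists S \<Longrightarrow> vs \<in> lists S \<Longrightarrow> s \<in> S \<Longrightarrow> t \<in> S \<Longrightarrow>
    coxeter_cong W S
      (us @ concat (replicate (group.ord W (s \<otimes>\<^bsub>W\<^esub> t)) [s, t]) @ vs) (us @ vs)"

text \<open>The last axiom says that \<open>W\<close> is presented by \<open>S\<close> and the relations above
  (the converse implication holds in every group).\<close>

locale coxeter_system = group W for W :: "('g, 'b) monoid_scheme" (structure) +
  fixes S :: "'g set"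
  assumes gens_closed: "S \<subseteq> carrier W"
    and gens_involution: "s \<in> S \<Longrightarrow> s \<noteq> \<one> \<and> s \<otimes> s = \<one>"
    and gens_generate: "generate W S = carrier W"
    and presentation: "us \<in> lists S \<Longrightarrow> vs \<in> lists S \<Longrightarrow>
      word_prod W us = word_prod W vs \<Longrightarrow> coxeter_cong W S us vs"

locale finite_coxeter_system = coxeter_system +
  assumes finite_carrier: "finite (carrier W)"

definition cox_length :: "('g, 'b) monoid_scheme \<Rightarrow> 'g set \<Rightarrow> 'g \<Rightarrow> nat" where
  "cox_length W S w = (LEAST n. \<exists>us\<in>lists S. length us = n \<and> word_prod W us = w)"

definition reduced_decomposition ::
    "('g, 'b) monoid_scheme \<Rightarrow> 'g set \<Rightarrow> 'g \<Rightarrow> 'g list \<Rightarrow> bool" where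
  "reduced_decomposition W S w us \<longleftrightarrow>
     us \<in> lists S \<and> word_prod W us = w \<and> length us = cox_length W S w"

definition longest_element :: "('g, 'b) monoid_scheme \<Rightarrow> 'g set \<Rightarrow> 'g \<Rightarrow> bool" where
  "longest_element W S w0 \<longleftrightarrow>
     w0 \<in> carrier W \<and> (\<forall>w\<in>carrier W. cox_length W S w \<le> cox_length W S w0)"

section \<open>Realizations\<close>

text \<open>A finite-dimensional real vector space is a normed space spanned by a finite set: its
  norm only serves to give the usual topology, on which the choice of norm has no influence,
  and every linear functional on it is bounded. Simple roots \<open>\<alpha> s\<close> and coroots \<open>\<alpha>v s\<close> are
  indexed by the generators. Linearity of the action \<open>\<rho>\<close> follows from
  \<open>reflection\<close>, since \<open>S\<close> generates \<open>W\<close>.\<close>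

locale finite_coxeter_realization = finite_coxeter_system W S
  for W :: "('g, 'b) monoid_scheme" (structure) and S +
  fixes \<alpha> :: "'g \<Rightarrow> 'v::real_normed_vector"
    and \<alpha>v :: "'g \<Rightarrow> 'v \<Rightarrow> real"
    and \<rho> :: "'g \<Rightarrow> 'v \<Rightarrow> 'v"
  assumes finite_dimensional: "\<exists>B :: 'v set. finite B \<and> span B = UNIV"
    and coroot_dual: "s \<in> S \<Longrightarrow> bounded_linear (\<alpha>v s)"
    and action: "group_action W (UNIV :: 'v set) \<rho>"
    and reflection: "s \<in> S \<Longrightarrow> \<rho> s x = x - \<alpha>v s x *\<^sub>R \<alpha> s"
    and coroot_root: "s \<in> S \<Longrightarrow> \<alpha>v s (\<alpha> s) = 2"
    and commuting: "s \<in> S \<Longrightarrow> t \<in> S \<Longrightarrow> s \<noteq> t \<Longrightarrow> ord (s \<otimes> t) = 2 \<Longrightarrow>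
      \<alpha>v s (\<alpha> t) = 0 \<and> \<alpha>v t (\<alpha> s) = 0"
    and noncommuting: "s \<in> S \<Longrightarrow> t \<in> S \<Longrightarrow> s \<noteq> t \<Longrightarrow> ord (s \<otimes> t) \<noteq> 2 \<Longrightarrow>
      \<alpha>v s (\<alpha> t) < 0 \<and> \<alpha>v t (\<alpha> s) < 0 \<and>
      \<alpha>v s (\<alpha> t) * \<alpha>v t (\<alpha> s) = 4 * (cos (pi / real (ord (s \<otimes> t))))\<^sup>2"

definition closed_chamber :: "'g set \<Rightarrow> ('g \<Rightarrow> 'v \<Rightarrow> real) \<Rightarrow> 'v set" where
  "closed_chamber S \<alpha>v = {v. \<forall>s\<in>S. \<alpha>v s v \<ge> 0}"

section \<open>Paths\<close>

text \<open>Paths on \<open>[0, T]\<close> are extensional functions, so that equality of paths is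
  equality on \<open>[0, T]\<close>.\<close>

definition paths0 :: "real \<Rightarrow> (real \<Rightarrow> 'v::real_normed_vector) set" where
  "paths0 T = {\<eta> \<in> extensional {0..T}. continuous_on {0..T} \<eta> \<and> \<eta> 0 = 0}"

definition dominant_paths0 ::
    "'g set \<Rightarrow> ('g \<Rightarrow> 'v \<Rightarrow> real) \<Rightarrow> real \<Rightarrow> (real \<Rightarrow> 'v::real_normed_vector) set" where
  "dominant_paths0 S \<alpha>v T = {\<eta> \<in> paths0 T. \<forall>t\<in>{0..T}. \<eta> t \<in> closed_chamber S \<alpha>v}"

text \<open>In the following definitions the arguments \<open>a\<close> and \<open>av\<close> are a simple root and its
  coroot.\<close>

definition pitman :: "real \<Rightarrow> 'v::real_normed_vector \<Rightarrow> ('v \<Rightarrow> real) \<Rightarrow> (real \<Rightarrow> 'v) \<Rightarrow> real \<Rightarrow> 'v" where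
  "pitman T a av \<eta> = (\<lambda>t\<in>{0..T}. \<eta> t - (INF s\<in>{0..t}. av (\<eta> s)) *\<^sub>R a)"

text \<open>The composition \<open>P_s1 \<circ> ... \<circ> P_sq\<close>, in which \<open>P_sq\<close> is applied first.\<close>

definition pitman_word ::
    "('g \<Rightarrow> 'v::real_normed_vector) \<Rightarrow> ('g \<Rightarrow> 'v \<Rightarrow> real) \<Rightarrow> real \<Rightarrow> 'g list \<Rightarrow> (real \<Rightarrow> 'v) \<Rightarrow> real \<Rightarrow> 'v" where
  "pitman_word \<alpha> \<alpha>v T us = foldr (\<lambda>s. pitman T (\<alpha> s) (\<alpha>v s)) us"

text \<open>\<open>L_\<pi>\<close>, for \<open>us\<close> a reduced decomposition of the longest element. The set does not
  depend on the choice of \<open>us\<close>.\<close>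

definition path_fibre ::
    "('g \<Rightarrow> 'v::real_normed_vector) \<Rightarrow> ('g \<Rightarrow> 'v \<Rightarrow> real) \<Rightarrow> real \<Rightarrow> 'g list \<Rightarrow> (real \<Rightarrow> 'v) \<Rightarrow> (real \<Rightarrow> 'v) set" where
  "path_fibre \<alpha> \<alpha>v T us \<pi> = {\<eta> \<in> paths0 T. pitman_word \<alpha> \<alpha>v T us \<eta> = \<pi>}"

text \<open>The Littelmann operator \<open>E_a^x\<close>. It is meaningful only for \<open>x\<close> between
  \<open>- av (\<eta> T) + inf av \<eta>\<close> and \<open>- inf av \<eta>\<close>; outside this range no such path exists.\<close>

definition littelmann ::
    "real \<Rightarrow> 'v::real_normed_vector \<Rightarrow> ('v \<Rightarrow> real) \<Rightarrow> real \<Rightarrow> (real \<Rightarrow> 'v) \<Rightarrow> real \<Rightarrow> 'v" where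
  "littelmann T a av x \<eta> =
     (THE \<xi>. \<xi> \<in> paths0 T \<and> pitman T a av \<xi> = pitman T a av \<eta> \<and> \<xi> T = \<eta> T + x *\<^sub>R a)"

definition simple_path_op ::
    "real \<Rightarrow> 'v::real_normed_vector \<Rightarrow> ('v \<Rightarrow> real) \<Rightarrow> (real \<Rightarrow> 'v) \<Rightarrow> real \<Rightarrow> 'v" where
  "simple_path_op T a av \<eta> = littelmann T a av (- av (\<eta> T)) \<eta>"

end

theory Submission
  imports Defs
begin

text \<open>Both the Pitman transforms \<open>P_\<alpha>\<close> and the operators \<open>S_\<alpha>\<close> are instances of one transform of
  paths on the whole line, \<open>\<eta>(t) - inf_{s \<le> t} \<alpha>\<^sup>\<or>(\<eta>(s)) \<alpha>\<close>. For \<open>P_\<alpha>\<close> a path on \<open>[0, T]\<close> is extended by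
  constants. For \<open>S_\<alpha>\<close> it is extended to a path with \<open>\<eta>(t + T) = \<eta>(t) + \<eta>(T)\<close>: if
  \<open>\<alpha>\<^sup>\<or>(\<eta>(T)) \<ge> 0\<close>, then \<open>S_\<alpha>\<close> is, up to an additive constant, the transform of the time-reversed
  extension.

  In rank two an alternating composition of at most \<open>m\<close> line transforms is given by nested infima with
  weights \<open>sin((k+1)\<pi>/m) / sin(\<pi>/m)\<close>. The weight for \<open>k = m - 1\<close> vanishes, so the two alternating
  compositions of length \<open>m\<close> agree. This yields the braid relation for the \<open>P_\<alpha>\<close>, and for the \<open>S_\<alpha>\<close>
  at paths whose endpoint is dominant for the dihedral group; as the \<open>S_\<alpha>\<close> are involutions and every
  endpoint can be reflected into the dominant cone, \<open>(S_\<alpha> S_\<beta>)^m = 1\<close> holds everywhere.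

  Finally, Matsumoto's theorem gives \<open>P_{w_0} P_\<alpha> = P_{w_0}\<close>; since \<open>P_\<alpha> S_\<alpha> = P_\<alpha>\<close>, the fibre
  \<open>L_\<pi>\<close> is stable under every \<open>S_\<alpha>\<close>, and the Coxeter presentation defines the action.\<close>

section \<open>Running infima\<close>

definition past_inf :: "(real \<Rightarrow> real) \<Rightarrow> real \<Rightarrow> real" where
  "past_inf z t = (INF s\<in>{..t}. z s)"

text \<open>\<open>Inf\<close> of a real set that is not bounded below is unspecified, so facts
  about \<open>past_inf\<close> carry this predicate.\<close>

definition bdd_past :: "(real \<Rightarrow> real) \<Rightarrow> bool" where
  "bdd_past z \<longleftrightarrow> (\<forall>t. bdd_below (z ` {..t}))"

lemma past_inf_le: "bdd_past z \<Longrightarrow> s \<le> t \<Longrightarrow> past_inf z t \<le> z s"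
  unfolding past_inf_def bdd_past_def by (auto intro: cINF_lower)

lemma past_inf_greatest: "(\<And>s. s \<le> t \<Longrightarrow> c \<le> z s) \<Longrightarrow> c \<le> past_inf z t"
  unfolding past_inf_def by (rule cINF_greatest) auto

lemma past_inf_antimono: "bdd_past z \<Longrightarrow> s \<le> t \<Longrightarrow> past_inf z t \<le> past_inf z s"
  by (rule past_inf_greatest) (simp add: past_inf_le)

lemma bdd_pastI: "(\<And>s t. s \<le> t \<Longrightarrow> f t \<le> z s) \<Longrightarrow> bdd_past z"
  unfolding bdd_past_def by (auto intro!: bdd_belowI)

lemma bdd_past_past_inf: "bdd_past z \<Longrightarrow> bdd_past (past_inf z)"
  by (rule bdd_pastI[of "past_inf z"]) (rule past_inf_antimono)

text \<open>\<open>past_inf z t\<close> is the smaller of \<open>past_inf z r\<close> and the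
  minimum of \<open>z\<close> over the compact interval from \<open>r\<close> to \<open>t\<close>; a
  strict drop leaves only the latter.\<close>

lemma past_inf_attained:
  assumes "continuous_on UNIV z" "bdd_past z" "r \<le> t" "past_inf z t < past_inf z r"
  shows "\<exists>s\<in>{r..t}. z s = past_inf z t"
proof -
  have "continuous_on {r..t} z"
    using assms(1) continuous_on_subset by blast
  then obtain s where s: "s \<in> {r..t}" "\<And>u. u \<in> {r..t} \<Longrightarrow> z s \<le> z u"
    using continuous_attains_inf[of "{r..t}" z] assms(3) by auto
  have "min (z s) (past_inf z r) \<le> past_inf z t"
  proof (rule past_inf_greatest)
    fix u assume "u \<le> t"
    show "min (z s) (past_inf z r) \<le> z u"
      by (cases "u \<le> r") (use past_inf_le[OF assms(2), of u r] s(2)[of u] \<open>u \<le> t\<close> in auto)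
  qed
  with assms(4) past_inf_le[OF assms(2), of s t] s(1) show ?thesis
    by (intro bexI[of _ s]) auto
qed

text \<open>The witness is the first time after \<open>r\<close> at which \<open>z\<close> is at
  most the level \<open>past_inf z r\<close>: continuity gives equality there, and no earlier value
  lies below the level.\<close>

lemma past_inf_hit:
  assumes "continuous_on UNIV z" "bdd_past z" "r \<le> t" "past_inf z t < past_inf z r"
  shows "\<exists>s\<in>{r..t}. z s = past_inf z r \<and> past_inf z s = past_inf z r"
proof -
  obtain u where u: "u \<in> {r..t}" "z u = past_inf z t"
    using past_inf_attained[OF assms] by blast
  define K where "K = {r..u} \<inter> z -` {..past_inf z r}"
  have "compact K" unfolding K_def
    by (intro compact_Int_closed closed_vimage) (use assms(1) in auto)
  moreover have "u \<in> K" using u assms(4) by (auto simp: K_def)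
  ultimately obtain s where s: "s \<in> K" "\<And>v. v \<in> K \<Longrightarrow> s \<le> v"
    using compact_attains_inf[of K] by auto
  have zr: "past_inf z r \<le> z r" by (simp add: past_inf_le assms(2))
  have zs: "z s = past_inf z r"
  proof (rule ccontr)
    assume "z s \<noteq> past_inf z r"
    then have "z s < past_inf z r" using s(1) by (auto simp: K_def)
    then obtain v where v: "r \<le> v" "v \<le> s" "z v = past_inf z r"
      using IVT2'[of z s "past_inf z r" r] zr s(1) assms(1) continuous_on_subset
      by (fastforce simp: K_def)
    then have "v \<in> K" using s(1) by (auto simp: K_def)
    with s(2) v have "v = s" by force
    with v(3) \<open>z s < past_inf z r\<close> show False by simp
  qed
  have "past_inf z r \<le> past_inf z s"
  proof (rule past_inf_greatest)
    fix v assume "v \<le> s"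
    show "past_inf z r \<le> z v"
    proof (rule ccontr)
      assume a: "\<not> past_inf z r \<le> z v"
      then have "v > r" using past_inf_le[OF assms(2), of v r] by force
      then have "v \<in> K" using a \<open>v \<le> s\<close> s(1) by (auto simp: K_def)
      with s(2) \<open>v \<le> s\<close> have "v = s" by force
      with a zs show False by simp
    qed
  qed
  moreover have "past_inf z s \<le> past_inf z r"
    using s(1) by (intro past_inf_antimono assms) (auto simp: K_def)
  ultimately show ?thesis using zs s(1) u(1) by (intro bexI[of _ s]) (auto simp: K_def)
qed

lemma continuous_on_past_inf:
  assumes "continuous_on UNIV z" "bdd_past z"
  shows "continuous_on UNIV (past_inf z)"
  unfolding continuous_on_iff
proof safe
  fix t e :: real assume "e > 0"
  then obtain d where d: "d > 0" "\<And>s. dist s t < d \<Longrightarrow> dist (z s) (z t) < e / 2"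
    using assms(1) unfolding continuous_on_iff by (metis half_gt_zero UNIV_I)
  \<comment> \<open>If the infimum drops between \<open>lo\<close> and \<open>hi\<close>, its new
    value is a value of \<open>z\<close> and its old one is at most \<open>z lo\<close>; so the drop
    is bounded by the oscillation of \<open>z\<close> near \<open>t\<close>.\<close>
  have close: "past_inf z lo - past_inf z hi < e"
    if lh: "lo \<le> hi" "\<And>s. s \<in> {lo..hi} \<Longrightarrow> dist s t < d" for lo hi
  proof (cases "past_inf z hi < past_inf z lo")
    case True
    then obtain s where "s \<in> {lo..hi}" "z s = past_inf z hi"
      using past_inf_attained[OF assms lh(1)] by blast
    moreover have "past_inf z lo \<le> z lo" by (simp add: past_inf_le assms)
    moreover have "dist (z s) (z t) < e / 2" "dist (z lo) (z t) < e / 2"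
      using calculation(1) lh(1) by (auto intro!: d(2) lh(2) simp del: less_divide_eq_numeral1)
    ultimately show ?thesis unfolding dist_real_def by linarith
  qed (use \<open>e > 0\<close> in auto)
  show "\<exists>d>0. \<forall>x'\<in>UNIV. dist x' t < d \<longrightarrow> dist (past_inf z x') (past_inf z t) < e"
  proof (intro exI[of _ d] conjI ballI impI)
    fix s assume s: "dist s t < d"
    show "dist (past_inf z s) (past_inf z t) < e"
    proof (cases "s \<le> t")
      case True
      then show ?thesis using close[of s t] s past_inf_antimono[OF assms(2), of s t]
        by (auto simp: dist_real_def)
    next
      case False
      then show ?thesis using close[of t s] s past_inf_antimono[OF assms(2), of t s]
        by (auto simp: dist_real_def)
    qed
  qed (use d in auto)
qed

text \<open>Pitman's duality: on \<open>[r, t]\<close> the minimum of \<open>z - 2 i\<close>, where \<open>i\<close> is the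
  running infimum of \<open>z\<close>, is that of \<open>z\<close> lowered by \<open>i r + i t\<close>. If \<open>i\<close> drops on \<open>[r, t]\<close>, the minimum
  of \<open>z - 2 i\<close> is attained where \<open>z\<close> first reaches the level \<open>i r\<close>; such a point exists by continuity.\<close>

lemma past_inf_reflect_le:
  assumes "continuous_on UNIV z" "bdd_past z" "s \<in> {r..t}"
  shows "\<exists>s'\<in>{r..t}. z s' \<le> z s - 2 * past_inf z s + past_inf z r + past_inf z t"
proof (cases "past_inf z t < past_inf z r")
  case True
  then obtain s' where "s' \<in> {r..t}" "z s' = past_inf z t"
    using past_inf_attained[OF assms(1,2), of r t] assms(3) by fastforce
  moreover have "past_inf z s \<le> z s" "past_inf z s \<le> past_inf z r"
    using assms by (auto intro: past_inf_le past_inf_antimono)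
  ultimately show ?thesis by (intro bexI[of _ s']) auto
next
  case False
  have "past_inf z t \<le> past_inf z s" "past_inf z s \<le> past_inf z r"
    using assms by (auto intro: past_inf_antimono)
  with False assms(3) show ?thesis by (intro bexI[of _ s]) auto
qed

lemma past_inf_reflect_ge:
  assumes "continuous_on UNIV z" "bdd_past z" "s \<in> {r..t}"
  shows "\<exists>s'\<in>{r..t}. z s' - 2 * past_inf z s' + past_inf z r + past_inf z t \<le> z s"
proof (cases "past_inf z t < past_inf z r")
  case True
  then obtain s' where "s' \<in> {r..t}" "z s' = past_inf z r" "past_inf z s' = past_inf z r"
    using past_inf_hit[OF assms(1,2), of r t] assms(3) by fastforce
  moreover have "past_inf z t \<le> z s"
    using assms by (auto intro: past_inf_le)
  ultimately show ?thesis by (intro bexI[of _ s']) auto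
next
  case False
  have "past_inf z t \<le> past_inf z s" "past_inf z s \<le> past_inf z r"
    using assms by (auto intro: past_inf_antimono)
  with False assms(3) show ?thesis by (intro bexI[of _ s]) auto
qed

lemma INF_reflect:
  assumes "continuous_on UNIV z" "bdd_past z" "r \<le> t"
  shows "(INF s\<in>{r..t}. z s - 2 * past_inf z s) = (INF s\<in>{r..t}. z s) - past_inf z r - past_inf z t"
proof (rule antisym)
  have le: "- past_inf z r \<le> z s - 2 * past_inf z s" if "s \<in> {r..t}" for s
    using that past_inf_le[OF assms(2), of s s] past_inf_antimono[OF assms(2), of r s] by auto
  have "(INF s\<in>{r..t}. z s - 2 * past_inf z s) + past_inf z r + past_inf z t \<le> (INF s\<in>{r..t}. z s)"
  proof (rule cINF_greatest)
    fix s assume "s \<in> {r..t}"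
    then obtain s' where "s' \<in> {r..t}" "z s' - 2 * past_inf z s' + past_inf z r + past_inf z t \<le> z s"
      using past_inf_reflect_ge[OF assms(1,2)] by blast
    moreover have "(INF s\<in>{r..t}. z s - 2 * past_inf z s) \<le> z s' - 2 * past_inf z s'"
      using le \<open>s' \<in> {r..t}\<close> by (intro cINF_lower bdd_belowI2) auto
    ultimately show "(INF s\<in>{r..t}. z s - 2 * past_inf z s) + past_inf z r + past_inf z t \<le> z s" by linarith
  qed (use assms in auto)
  then show "(INF s\<in>{r..t}. z s - 2 * past_inf z s) \<le> (INF s\<in>{r..t}. z s) - past_inf z r - past_inf z t"
    by linarith
next
  show "(INF s\<in>{r..t}. z s) - past_inf z r - past_inf z t \<le> (INF s\<in>{r..t}. z s - 2 * past_inf z s)"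
  proof (rule cINF_greatest)
    fix s assume "s \<in> {r..t}"
    then obtain s' where "s' \<in> {r..t}" "z s' \<le> z s - 2 * past_inf z s + past_inf z r + past_inf z t"
      using past_inf_reflect_le[OF assms(1,2)] by blast
    moreover have "(INF s\<in>{r..t}. z s) \<le> z s'"
      using \<open>s' \<in> {r..t}\<close> past_inf_le[OF assms(2), of _ t]
      by (intro cINF_lower bdd_belowI2[of _ "past_inf z t"]) auto
    ultimately show "(INF s\<in>{r..t}. z s) - past_inf z r - past_inf z t \<le> z s - 2 * past_inf z s" by linarith
  qed (use assms in auto)
qed

text \<open>Both sides are infima over pairs \<open>r \<le> s \<le> t\<close>. For fixed
  \<open>r\<close>, Pitman's duality on the interval from \<open>r\<close> to \<open>t\<close>,
  multiplied by \<open>u\<close>, trades \<open>z - 2 * past_inf z\<close> for \<open>z\<close>; its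
  boundary term at \<open>r\<close> is the one placed inside \<open>h\<close>, the one at
  \<open>t\<close> comes out as the correction.\<close>

lemma past_inf_exchange:
  assumes z: "continuous_on UNIV z" "bdd_past z" and g: "bdd_past g" and u: "0 \<le> u"
  defines "h \<equiv> past_inf (\<lambda>r. g r + u * past_inf z r)"
  shows "bdd_past (\<lambda>s. u * (z s - 2 * past_inf z s) + h s)"
    and "past_inf (\<lambda>s. u * (z s - 2 * past_inf z s) + h s) t =
      past_inf (\<lambda>s. u * z s + past_inf g s) t - u * past_inf z t"
proof -
  let ?f = "\<lambda>s. u * z s + past_inf g s"
  have gi: "bdd_past (\<lambda>r. g r + u * past_inf z r)"
    using past_inf_le[OF g] past_inf_antimono[OF z(2)] u
    by (intro bdd_pastI[of "\<lambda>t. past_inf g t + u * past_inf z t"]) (simp add: add_mono mult_left_mono)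
  have f: "bdd_past ?f"
    using past_inf_antimono[OF g] past_inf_le[OF z(2)] u
    by (intro bdd_pastI[of "\<lambda>t. u * past_inf z t + past_inf g t"]) (simp add: add_mono mult_left_mono)
  have ge: "past_inf ?f t - u * past_inf z t \<le> u * (z s - 2 * past_inf z s) + h s" if st: "s \<le> t" for s t
  proof -
    have "past_inf ?f t - u * past_inf z t - u * (z s - 2 * past_inf z s) \<le> h s"
      unfolding h_def
    proof (rule past_inf_greatest)
      fix r assume "r \<le> s"
      then obtain s' where s': "s' \<in> {r..t}" "z s' \<le> z s - 2 * past_inf z s + past_inf z r + past_inf z t"
        using past_inf_reflect_le[OF z, of s r t] st by fastforce
      have "past_inf ?f t \<le> ?f s'" using s' by (intro past_inf_le f) auto
      also have "\<dots> \<le> u * (z s - 2 * past_inf z s + past_inf z r + past_inf z t) + g r"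
        using s' u past_inf_le[OF g, of r s'] by (auto intro!: add_mono mult_left_mono)
      finally show "past_inf ?f t - u * past_inf z t - u * (z s - 2 * past_inf z s) \<le> g r + u * past_inf z r"
        by (simp add: algebra_simps)
    qed
    then show ?thesis by simp
  qed
  show bdd: "bdd_past (\<lambda>s. u * (z s - 2 * past_inf z s) + h s)"
    by (rule bdd_pastI) (rule ge)
  let ?L = "past_inf (\<lambda>s. u * (z s - 2 * past_inf z s) + h s) t"
  show "?L = past_inf ?f t - u * past_inf z t"
  proof (rule antisym)
    show "past_inf ?f t - u * past_inf z t \<le> ?L"
      by (rule past_inf_greatest) (rule ge)
    have "?L + u * past_inf z t \<le> past_inf ?f t"
    proof (rule past_inf_greatest)
      fix s assume "s \<le> t"
      have "?L + u * past_inf z t - u * z s \<le> past_inf g s"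
      proof (rule past_inf_greatest)
        fix r assume "r \<le> s"
        then obtain s' where s': "s' \<in> {r..t}" "z s' - 2 * past_inf z s' + past_inf z r + past_inf z t \<le> z s"
          using past_inf_reflect_ge[OF z, of s r t] \<open>s \<le> t\<close> by fastforce
        have "?L \<le> u * (z s' - 2 * past_inf z s') + h s'"
          using s' past_inf_le[OF bdd, of s' t] by auto
        moreover have "h s' \<le> g r + u * past_inf z r"
          unfolding h_def using s' past_inf_le[OF gi, of r s'] by auto
        moreover have "u * (z s' - 2 * past_inf z s' + past_inf z r + past_inf z t) \<le> u * z s"
          using s' u by (intro mult_left_mono) auto
        ultimately show "?L + u * past_inf z t - u * z s \<le> g r"
          by (simp add: algebra_simps)
      qed
      then show "?L + u * past_inf z t \<le> u * z s + past_inf g s" by simp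
    qed
    then show "?L \<le> past_inf ?f t - u * past_inf z t" by simp
  qed
qed

lemma bdd_past_add:
  assumes "bdd_past f" "bdd_past g"
  shows "bdd_past (\<lambda>s. f s + g s)"
  by (rule bdd_pastI[of "\<lambda>t. past_inf f t + past_inf g t"]) (intro add_mono past_inf_le assms)

lemma bdd_past_cmult: "bdd_past f \<Longrightarrow> 0 \<le> u \<Longrightarrow> bdd_past (\<lambda>s. u * f s)"
  by (rule bdd_pastI[of "\<lambda>t. u * past_inf f t"]) (intro mult_left_mono past_inf_le)

lemma past_inf_cmult:
  assumes "bdd_past z" "0 \<le> u"
  shows "past_inf (\<lambda>s. u * z s) t = u * past_inf z t"
proof (cases "u = 0")
  case True
  then show ?thesis by (simp add: past_inf_def)
next
  case False
  have "past_inf (\<lambda>s. u * z s) t / u \<le> past_inf z t"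
  proof (rule past_inf_greatest)
    fix s assume "s \<le> t"
    then show "past_inf (\<lambda>s. u * z s) t / u \<le> z s"
      using False assms past_inf_le[OF bdd_past_cmult[OF assms] \<open>s \<le> t\<close>] by (simp add: field_simps)
  qed
  moreover have "u * past_inf z t \<le> past_inf (\<lambda>s. u * z s) t"
    by (intro past_inf_greatest mult_left_mono past_inf_le assms)
  ultimately show ?thesis using False assms(2) by (simp add: field_simps)
qed

section \<open>Nested infima and the dihedral braid relation\<close>

text \<open>The value at \<open>t\<close> is the infimum of \<open>U k * x s1 + U (k + 1) * y s2 + U (k + 2) * x s3 + ...\<close>
  (\<open>n\<close> terms) over \<open>t \<ge> s1 \<ge> s2 \<ge> ...\<close>. Since \<open>Inf\<close> of a real set that is not bounded below is
  unspecified, boundedness at every level is recorded separately by \<open>nested_bdd\<close>.\<close>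

fun nested_inf :: "(nat \<Rightarrow> real) \<Rightarrow> (real \<Rightarrow> real) \<Rightarrow> (real \<Rightarrow> real) \<Rightarrow> nat \<Rightarrow> nat \<Rightarrow> real \<Rightarrow> real" where
  "nested_inf U x y k 0 = (\<lambda>t. 0)"
| "nested_inf U x y k (Suc n) = past_inf (\<lambda>s. U k * x s + nested_inf U y x (Suc k) n s)"

fun nested_bdd :: "(nat \<Rightarrow> real) \<Rightarrow> (real \<Rightarrow> real) \<Rightarrow> (real \<Rightarrow> real) \<Rightarrow> nat \<Rightarrow> nat \<Rightarrow> bool" where
  "nested_bdd U x y k 0 = True"
| "nested_bdd U x y k (Suc n) \<longleftrightarrow> nested_bdd U y x (Suc k) n \<and>
     bdd_past (\<lambda>s. U k * x s + nested_inf U y x (Suc k) n s)"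

lemma nested_bddI:
  assumes "\<And>i. i < n \<Longrightarrow> 0 \<le> U (k + i)" "bdd_past x" "bdd_past y"
  shows "nested_bdd U x y k n \<and> bdd_past (nested_inf U x y k n)"
  using assms
proof (induction n arbitrary: x y k)
  case 0
  then show ?case by (auto intro: bdd_pastI[of "\<lambda>_. 0"])
next
  case (Suc n)
  have "nested_bdd U y x (Suc k) n \<and> bdd_past (nested_inf U y x (Suc k) n)"
    using Suc.prems(1)[of "Suc _"] by (intro Suc.IH Suc.prems) auto
  moreover have "bdd_past (\<lambda>s. U k * x s)"
    using Suc.prems(1)[of 0] Suc.prems(2) by (simp add: bdd_past_cmult)
  ultimately show ?case by (simp add: bdd_past_add bdd_past_past_inf)
qed

text \<open>The innermost level involves the last path alone, with a positive weight to divide by.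
  The first transform applied in an alternation acts on this path and needs its boundedness.\<close>

lemma nested_bdd_last:
  "nested_bdd U x y k (Suc l) \<Longrightarrow> 0 < U (k + l) \<Longrightarrow> bdd_past (if even l then x else y)"
proof (induction l arbitrary: x y k)
  case 0
  then have "bdd_past (\<lambda>s. inverse (U k) * (U k * x s))"
    using bdd_past_cmult[of "\<lambda>s. U k * x s" "inverse (U k)"] by auto
  moreover have eq: "(\<lambda>s. inverse (U k) * (U k * x s)) = x" using 0 by auto
  ultimately show ?case by (simp only: eq even_zero if_True)
next
  case (Suc l)
  have "bdd_past (if even l then y else x)"
    by (rule Suc.IH[of _ _ "Suc k"]) (use Suc.prems in auto)
  then show ?case by (auto split: if_splits)
qed

text \<open>A zero weight makes the innermost infimum that of the zero function.\<close>

lemma nested_inf_drop: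
  "U (k + n) = 0 \<Longrightarrow> nested_inf U x y k (Suc n) = nested_inf U x y k n"
proof (induction n arbitrary: x y k)
  case 0
  then show ?case by (simp add: past_inf_def fun_eq_iff)
next
  case (Suc n)
  from Suc.IH[of "Suc k" y x] Suc.prems show ?case by simp
qed

text \<open>Passing from \<open>(z, w)\<close> to \<open>(z', w')\<close> shortens the chain by its last term, which has type \<open>z\<close>:
  by the recursion for \<open>U\<close>, the infima \<open>i\<close> hidden in two consecutive terms of type \<open>w'\<close> supply the
  boundary terms \<open>i r + i t\<close> of Pitman's duality for the term of type \<open>z'\<close> between them.\<close>

lemma nested_inf_reflect_odd:
  fixes z w :: "real \<Rightarrow> real" and U :: "nat \<Rightarrow> real" and p :: real
  defines "z' \<equiv> \<lambda>s. z s - 2 * past_inf z s" and "w' \<equiv> \<lambda>s. w s + p * past_inf z s"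
  assumes z: "continuous_on UNIV z" "bdd_past z"
    and U: "\<And>k. U (Suc k) * p = U (Suc (Suc k)) + U k"
  shows "(\<And>i. i \<le> 2 * j \<Longrightarrow> 0 \<le> U (k + i)) \<Longrightarrow> nested_bdd U z w k (Suc (2 * j)) \<Longrightarrow>
    nested_bdd U z' w' k (2 * j) \<and>
    (\<forall>t. nested_inf U z' w' k (2 * j) t = nested_inf U z w k (Suc (2 * j)) t - U k * past_inf z t)"
proof (induction j arbitrary: k)
  case 0
  then show ?case using 0(1)[of 0] by (simp add: past_inf_cmult[OF z(2)])
next
  case (Suc j)
  let ?i = "past_inf z"
  let ?D = "nested_inf U z w (Suc (Suc k)) (Suc (2 * j))"
  define g where "g = (\<lambda>s. U (Suc k) * w s + ?D s)"
  have Uk: "0 \<le> U k" using Suc.prems(1)[of 0] by simp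
  have IH: "nested_bdd U z' w' (Suc (Suc k)) (2 * j)"
    "nested_inf U z' w' (Suc (Suc k)) (2 * j) t = ?D t - U (Suc (Suc k)) * ?i t" for t
    using Suc.IH[of "Suc (Suc k)"] Suc.prems(1)[of "Suc (Suc _)"] Suc.prems(2) by auto
  have g: "bdd_past g" using Suc.prems(2) by (simp add: g_def)
  have w'_at: "w' s = w s + p * ?i s" for s by (simp add: w'_def)
  \<comment> \<open>Of the shift by \<open>(U (Suc (Suc k)) + U k) * ?i s\<close>, the first part
    cancels the correction from the induction hypothesis; the second is what
    \<open>past_inf_exchange\<close> expects.\<close>
  have inner: "(\<lambda>s. U (Suc k) * w' s + nested_inf U z' w' (Suc (Suc k)) (2 * j) s) = (\<lambda>s. g s + U k * ?i s)"
  proof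
    fix s
    have "U (Suc k) * (p * ?i s) = (U (Suc (Suc k)) + U k) * ?i s"
      by (simp add: U[symmetric])
    then show "U (Suc k) * w' s + nested_inf U z' w' (Suc (Suc k)) (2 * j) s = g s + U k * ?i s"
      using IH(2)[of s] by (simp add: g_def w'_at algebra_simps del: nested_inf.simps)
  qed
  have "bdd_past (\<lambda>s. g s + U k * ?i s)"
    by (intro bdd_past_add bdd_past_cmult bdd_past_past_inf g z Uk)
  then have 1: "nested_bdd U w' z' (Suc k) (Suc (2 * j))"
    using IH(1) by (simp only: nested_bdd.simps inner)
  have 2: "nested_inf U w' z' (Suc k) (Suc (2 * j)) = past_inf (\<lambda>s. g s + U k * ?i s)"
    by (simp only: nested_inf.simps inner)
  have 3: "nested_inf U z w k (Suc (Suc (Suc (2 * j)))) = past_inf (\<lambda>s. U k * z s + past_inf g s)"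
    by (simp add: g_def)
  show ?case
    using past_inf_exchange[OF z g Uk] 1
    by (simp only: 3 nested_inf.simps(2)[of U z' w'] nested_bdd.simps(2)[of U z' w'] mult_Suc_right add_2_eq_Suc 2) (simp add: z'_def)
qed

text \<open>The outermost term is now of type \<open>w'\<close>: its shift,
  \<open>U 0 * p = U 1\<close> times \<open>past_inf z\<close>, cancels the correction of the odd
  case exactly. The condition on \<open>U 0\<close> is the recursion with a vanishing weight before
  \<open>U 0\<close>.\<close>

lemma nested_inf_reflect_even:
  fixes z w :: "real \<Rightarrow> real" and U :: "nat \<Rightarrow> real" and p :: real
  defines "z' \<equiv> \<lambda>s. z s - 2 * past_inf z s" and "w' \<equiv> \<lambda>s. w s + p * past_inf z s"
  assumes z: "continuous_on UNIV z" "bdd_past z"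
    and U: "\<And>k. U (Suc k) * p = U (Suc (Suc k)) + U k" and U0: "U 0 * p = U 1"
    and pos: "\<And>i. i \<le> Suc (2 * j) \<Longrightarrow> 0 \<le> U i"
    and bdd: "nested_bdd U w z 0 (Suc (Suc (2 * j)))"
  shows "nested_bdd U w' z' 0 (Suc (2 * j)) \<and>
    nested_inf U w' z' 0 (Suc (2 * j)) = nested_inf U w z 0 (Suc (Suc (2 * j)))"
proof -
  have odd: "nested_bdd U z' w' 1 (2 * j)"
    "nested_inf U z' w' 1 (2 * j) t = nested_inf U z w 1 (Suc (2 * j)) t - U 1 * past_inf z t" for t
    using nested_inf_reflect_odd[OF z, of U p j 1 w, OF U] pos bdd by (auto simp: z'_def w'_def)
  have w'_at: "w' s = w s + p * past_inf z s" for s by (simp add: w'_def)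
  have inner: "(\<lambda>s. U 0 * w' s + nested_inf U z' w' 1 (2 * j) s) =
      (\<lambda>s. U 0 * w s + nested_inf U z w 1 (Suc (2 * j)) s)"
  proof
    fix s
    have "U 0 * (p * past_inf z s) = U 1 * past_inf z s" by (simp only: U0[symmetric] mult.assoc)
    then show "U 0 * w' s + nested_inf U z' w' 1 (2 * j) s =
        U 0 * w s + nested_inf U z w 1 (Suc (2 * j)) s"
      using odd(2)[of s] by (simp only: w'_at distrib_left)
  qed
  show ?thesis using odd(1) bdd inner by simp
qed

section \<open>Pitman transforms on the line and their alternating compositions\<close>

definition line_pitman :: "'v::real_normed_vector \<Rightarrow> ('v \<Rightarrow> real) \<Rightarrow> (real \<Rightarrow> 'v) \<Rightarrow> real \<Rightarrow> 'v" where
  "line_pitman a av g = (\<lambda>t. g t - past_inf (\<lambda>s. av (g s)) t *\<^sub>R a)"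

lemma continuous_line_pitman:
  assumes "bounded_linear av" "continuous_on UNIV g" "bdd_past (\<lambda>s. av (g s))"
  shows "continuous_on UNIV (line_pitman a av g)"
  unfolding line_pitman_def
  by (intro continuous_intros continuous_on_past_inf bounded_linear.continuous_on[OF assms(1)] assms)

fun alternate :: "('a \<Rightarrow> 'a) \<Rightarrow> ('a \<Rightarrow> 'a) \<Rightarrow> nat \<Rightarrow> 'a \<Rightarrow> 'a" where
  "alternate f h 0 = id"
| "alternate f h (Suc n) = f \<circ> alternate h f n"

lemma alternate_Suc_right: "alternate f h (Suc n) = alternate f h n \<circ> (if even n then f else h)"
proof (induction n arbitrary: f h)
  case (Suc n)
  have "alternate f h (Suc (Suc n)) = f \<circ> (alternate h f n \<circ> (if even n then h else f))"
    by (simp only: alternate.simps(2)[of f h] Suc.IH)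
  then show ?case by (simp add: comp_assoc)
qed simp

text \<open>Chebyshev polynomials of the second kind at \<open>cos (pi / m)\<close>; for
  \<open>m \<ge> 2\<close> the first zero is at index \<open>m - 1\<close>.\<close>

definition dihedral_weight :: "nat \<Rightarrow> nat \<Rightarrow> real" where
  "dihedral_weight m k = sin (real (Suc k) * (pi / real m)) / sin (pi / real m)"

lemma dihedral_weight_Suc:
  "dihedral_weight m (Suc k) * (2 * cos (pi / real m)) = dihedral_weight m (Suc (Suc k)) + dihedral_weight m k"
proof -
  let ?A = "real (Suc (Suc k)) * (pi / real m)" and ?t = "pi / real m"
  have "sin (?A + ?t) + sin (?A - ?t) = 2 * sin ?A * cos ?t"
    by (simp add: sin_add sin_diff)
  moreover have "?A + ?t = real (Suc (Suc (Suc k))) * ?t" "?A - ?t = real (Suc k) * ?t"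
    by (simp_all add: field_simps add_divide_distrib)
  ultimately show ?thesis
    unfolding dihedral_weight_def by (simp only: add_divide_distrib[symmetric]) simp
qed

context
  fixes m :: nat assumes m: "2 \<le> m"
begin

lemma sin_pi_div_pos: "0 < sin (pi / real m)"
  using m by (intro sin_gt_zero) (auto simp: field_simps)

lemma dihedral_weight_0: "dihedral_weight m 0 = 1"
  using sin_pi_div_pos by (simp add: dihedral_weight_def)

lemma dihedral_weight_1: "dihedral_weight m (Suc 0) = 2 * cos (pi / real m)"
  using sin_pi_div_pos sin_double[of "pi / real m"] by (simp add: dihedral_weight_def)

lemma dihedral_weight_last: "dihedral_weight m (m - 1) = 0"
  using m by (simp add: dihedral_weight_def)

lemma dihedral_weight_pos: "Suc k < m \<Longrightarrow> 0 < dihedral_weight m k"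
  unfolding dihedral_weight_def using sin_pi_div_pos m
  by (intro divide_pos_pos sin_gt_zero) (auto simp: field_simps simp del: of_nat_Suc)

lemma dihedral_weight_nonneg: "k < m \<Longrightarrow> 0 \<le> dihedral_weight m k"
  using dihedral_weight_pos[of k] dihedral_weight_last
  by (cases "Suc k < m") (auto simp: less_Suc_eq_le not_less_eq le_antisym dest: le_antisym)

end

text \<open>The two off-diagonal pairings are taken equal; a general realization is brought to this
  form later by rescaling one root.\<close>

locale dihedral_roots =
  fixes a b :: "'v::real_normed_vector" and av bv :: "'v \<Rightarrow> real" and m :: nat
  assumes av: "bounded_linear av" and bv: "bounded_linear bv" and m: "2 \<le> m"
    and av_a: "av a = 2" and bv_b: "bv b = 2"
    and av_b: "av b = - 2 * cos (pi / real m)" and bv_a: "bv a = - 2 * cos (pi / real m)"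
begin

lemma swap: "dihedral_roots b a bv av m"
  using dihedral_roots_axioms unfolding dihedral_roots_def by simp

abbreviation "U \<equiv> dihedral_weight m"

sublocale av: bounded_linear av by (rule av)
sublocale bv: bounded_linear bv by (rule bv)

lemma line_pitman_av:
  "(\<lambda>s. av (line_pitman a av g s)) = (\<lambda>s. av (g s) - 2 * past_inf (\<lambda>s. av (g s)) s)"
  by (simp add: line_pitman_def av.diff av.scale av_a fun_eq_iff)

lemma line_pitman_bv:
  "(\<lambda>s. bv (line_pitman a av g s)) = (\<lambda>s. bv (g s) + (2 * cos (pi / real m)) * past_inf (\<lambda>s. av (g s)) s)"
  by (simp add: line_pitman_def bv.diff bv.scale bv_a fun_eq_iff)

text \<open>Induction on the number of transforms, with the innermost one split off: the two
  reflection lemmas rewrite the chains of the transformed path into chains in \<open>g\<close> that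
  are one term longer. The hypotheses bound chains rather than the two pairings, because a transform
  can destroy boundedness of a pairing, whereas the shortened chains inherit theirs.\<close>

lemma alternate_line_pitman:
  assumes "Suc n \<le> m" "continuous_on UNIV g"
    and "nested_bdd U (\<lambda>s. av (g s)) (\<lambda>s. bv (g s)) 0 (Suc n)"
    and "nested_bdd U (\<lambda>s. bv (g s)) (\<lambda>s. av (g s)) 0 n"
  shows "alternate (line_pitman a av) (line_pitman b bv) (Suc n) g =
    (\<lambda>t. g t - nested_inf U (\<lambda>s. av (g s)) (\<lambda>s. bv (g s)) 0 (Suc n) t *\<^sub>R a
             - nested_inf U (\<lambda>s. bv (g s)) (\<lambda>s. av (g s)) 0 n t *\<^sub>R b)"
  using assms
proof (induction n arbitrary: g)
  case 0
  then show ?case using m by (simp add: line_pitman_def dihedral_weight_0)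
next
  case (Suc n)
  interpret s: dihedral_roots b a bv av m by (rule swap)
  let ?x = "\<lambda>s. av (g s)" and ?y = "\<lambda>s. bv (g s)"
  have cx: "continuous_on UNIV ?x" and cy: "continuous_on UNIV ?y"
    using Suc.prems(2) by (auto intro: av.continuous_on bv.continuous_on)
  \<comment> \<open>The last weight \<open>U n\<close> is positive since
    \<open>Suc (Suc n) \<le> m\<close>.\<close>
  have last: "bdd_past (if even n then ?y else ?x)"
    using Suc.prems(1) by (intro nested_bdd_last[OF Suc.prems(4)] dihedral_weight_pos m) auto
  have pos: "i \<le> Suc n \<Longrightarrow> 0 \<le> U i" for i
    using Suc.prems(1) by (intro dihedral_weight_nonneg m) auto
  have U0: "U 0 * (2 * cos (pi / real m)) = U 1"
    using m by (simp add: dihedral_weight_0 dihedral_weight_1)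
  have step: "alternate (line_pitman a av) (line_pitman b bv) (Suc (Suc n)) g =
    alternate (line_pitman a av) (line_pitman b bv) (Suc n) (if even (Suc n) then line_pitman a av g else line_pitman b bv g)"
    by (subst alternate_Suc_right) simp
  show ?case
  \<comment> \<open>Parity decides which transform comes first. The chain that starts and ends with
    the pairing of its root has odd length, and its correction is the multiple of the root
    subtracted by that transform; the other chain has even length and needs no correction.\<close>
  proof (cases "even n")
    case True
    then obtain j where j: "n = 2 * j" by (rule evenE)
    let ?g = "line_pitman b bv g"
    have bb: "bdd_past ?y" using last True by simp
    note odd = nested_inf_reflect_odd[OF cy bb, of U "2 * cos (pi / real m)" j 0 ?x, OF dihedral_weight_Suc,
        folded s.line_pitman_av s.line_pitman_bv j]
    note even = nested_inf_reflect_even[OF cy bb, of U "2 * cos (pi / real m)" j ?x, OF dihedral_weight_Suc U0,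
        folded s.line_pitman_av s.line_pitman_bv j]
    have o: "nested_bdd U (\<lambda>s. bv (?g s)) (\<lambda>s. av (?g s)) 0 n"
      "\<And>t. nested_inf U (\<lambda>s. bv (?g s)) (\<lambda>s. av (?g s)) 0 n t = nested_inf U ?y ?x 0 (Suc n) t - past_inf ?y t"
      using odd pos Suc.prems(4) m by (simp_all add: dihedral_weight_0 del: nested_inf.simps nested_bdd.simps)
    have e: "nested_bdd U (\<lambda>s. av (?g s)) (\<lambda>s. bv (?g s)) 0 (Suc n)"
      "nested_inf U (\<lambda>s. av (?g s)) (\<lambda>s. bv (?g s)) 0 (Suc n) = nested_inf U ?x ?y 0 (Suc (Suc n))"
      using even pos Suc.prems(3) by (simp_all del: nested_inf.simps nested_bdd.simps)
    have "alternate (line_pitman a av) (line_pitman b bv) (Suc n) ?g =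
      (\<lambda>t. ?g t - nested_inf U (\<lambda>s. av (?g s)) (\<lambda>s. bv (?g s)) 0 (Suc n) t *\<^sub>R a
             - nested_inf U (\<lambda>s. bv (?g s)) (\<lambda>s. av (?g s)) 0 n t *\<^sub>R b)"
      using Suc.prems(1) by (intro Suc.IH continuous_line_pitman bv Suc.prems(2) bb o e) simp
    then show ?thesis
      using True by (simp only: step o(2) e(2)) (simp add: line_pitman_def algebra_simps fun_eq_iff del: nested_inf.simps alternate.simps)
  next
    case False
    then obtain j where j: "n = Suc (2 * j)" using oddE by fastforce
    let ?g = "line_pitman a av g"
    have bx: "bdd_past ?x" using last False by simp
    note odd = nested_inf_reflect_odd[OF cx bx, of U "2 * cos (pi / real m)" "Suc j" 0 ?y, OF dihedral_weight_Suc,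
        folded line_pitman_av line_pitman_bv, unfolded mult_Suc_right add_2_eq_Suc, folded j]
    note even = nested_inf_reflect_even[OF cx bx, of U "2 * cos (pi / real m)" j ?y, OF dihedral_weight_Suc U0,
        folded line_pitman_av line_pitman_bv j]
    have o: "nested_bdd U (\<lambda>s. av (?g s)) (\<lambda>s. bv (?g s)) 0 (Suc n)"
      "\<And>t. nested_inf U (\<lambda>s. av (?g s)) (\<lambda>s. bv (?g s)) 0 (Suc n) t = nested_inf U ?x ?y 0 (Suc (Suc n)) t - past_inf ?x t"
      using odd pos Suc.prems(3) m by (simp_all add: dihedral_weight_0 del: nested_inf.simps nested_bdd.simps)
    have e: "nested_bdd U (\<lambda>s. bv (?g s)) (\<lambda>s. av (?g s)) 0 n"
      "nested_inf U (\<lambda>s. bv (?g s)) (\<lambda>s. av (?g s)) 0 n = nested_inf U ?y ?x 0 (Suc n)"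
      using even pos Suc.prems(4) by (simp_all del: nested_inf.simps nested_bdd.simps)
    have "alternate (line_pitman a av) (line_pitman b bv) (Suc n) ?g =
      (\<lambda>t. ?g t - nested_inf U (\<lambda>s. av (?g s)) (\<lambda>s. bv (?g s)) 0 (Suc n) t *\<^sub>R a
             - nested_inf U (\<lambda>s. bv (?g s)) (\<lambda>s. av (?g s)) 0 n t *\<^sub>R b)"
      using Suc.prems(1) by (intro Suc.IH continuous_line_pitman av Suc.prems(2) bx o e) simp
    then show ?thesis
      using False by (simp only: step o(2) e(2)) (simp add: line_pitman_def algebra_simps fun_eq_iff del: nested_inf.simps alternate.simps)
  qed
qed

text \<open>In the closed formula for \<open>m\<close> transforms the longer chain ends with the
  weight \<open>U (m - 1) = 0\<close>. Without that term both compositions subtract the same two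
  chains of length \<open>m - 1\<close>.\<close>

lemma line_pitman_braid:
  assumes g: "continuous_on UNIV g" "bdd_past (\<lambda>s. av (g s))" "bdd_past (\<lambda>s. bv (g s))"
  shows "alternate (line_pitman a av) (line_pitman b bv) m g = alternate (line_pitman b bv) (line_pitman a av) m g"
proof -
  interpret s: dihedral_roots b a bv av m by (rule swap)
  obtain n where n: "m = Suc n" using m by (cases m) auto
  have bdd: "k \<le> m \<Longrightarrow> nested_bdd U (\<lambda>s. av (g s)) (\<lambda>s. bv (g s)) 0 k"
    "k \<le> m \<Longrightarrow> nested_bdd U (\<lambda>s. bv (g s)) (\<lambda>s. av (g s)) 0 k" for k
    using nested_bddI[of k U 0] g m by (simp_all add: dihedral_weight_nonneg)
  have "U (0 + n) = 0" using dihedral_weight_last[OF m] by (simp add: n)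
  note drop = nested_inf_drop[of U 0 n, OF this]
  have 1: "alternate (line_pitman a av) (line_pitman b bv) (Suc n) g =
    (\<lambda>t. g t - nested_inf U (\<lambda>s. av (g s)) (\<lambda>s. bv (g s)) 0 (Suc n) t *\<^sub>R a
             - nested_inf U (\<lambda>s. bv (g s)) (\<lambda>s. av (g s)) 0 n t *\<^sub>R b)"
    by (intro alternate_line_pitman g bdd) (auto simp: n)
  have 2: "alternate (line_pitman b bv) (line_pitman a av) (Suc n) g =
    (\<lambda>t. g t - nested_inf U (\<lambda>s. bv (g s)) (\<lambda>s. av (g s)) 0 (Suc n) t *\<^sub>R b
             - nested_inf U (\<lambda>s. av (g s)) (\<lambda>s. bv (g s)) 0 n t *\<^sub>R a)"
    by (intro s.alternate_line_pitman g bdd) (auto simp: n)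
  have "alternate (line_pitman a av) (line_pitman b bv) (Suc n) g =
    alternate (line_pitman b bv) (line_pitman a av) (Suc n) g"
    unfolding 1 2 drop by (simp add: algebra_simps)
  then show ?thesis by (simp only: n[symmetric])
qed

end

section \<open>Paths on an interval\<close>

definition extend_path :: "real \<Rightarrow> (real \<Rightarrow> 'v) \<Rightarrow> real \<Rightarrow> 'v" where
  "extend_path T \<eta> t = \<eta> (min T (max 0 t))"

definition forward_path :: "real \<Rightarrow> (real \<Rightarrow> 'v::real_normed_vector) \<Rightarrow> real \<Rightarrow> 'v" where
  "forward_path T g = (\<lambda>t\<in>{0..T}. g t - g 0)"

definition backward_path :: "real \<Rightarrow> (real \<Rightarrow> 'v::real_normed_vector) \<Rightarrow> real \<Rightarrow> 'v" where
  "backward_path T g = (\<lambda>t\<in>{0..T}. g (- t) - g 0)"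

definition quasi_extend :: "real \<Rightarrow> (real \<Rightarrow> 'v::real_normed_vector) \<Rightarrow> real \<Rightarrow> 'v" where
  "quasi_extend T \<eta> t = \<eta> (t - real_of_int \<lfloor>t / T\<rfloor> * T) + real_of_int \<lfloor>t / T\<rfloor> *\<^sub>R \<eta> T"

text \<open>\<open>v\<close> is the increment for a step back by \<open>T\<close>. With this sign,
  \<open>av v \<ge> 0\<close> keeps \<open>av (g s)\<close> bounded below on past half-lines, and
  \<open>backward_path T g\<close> ends at \<open>v\<close>.\<close>

definition quasi_periodic :: "real \<Rightarrow> 'v::real_normed_vector \<Rightarrow> (real \<Rightarrow> 'v) \<Rightarrow> bool" where
  "quasi_periodic T v g \<longleftrightarrow> continuous_on UNIV g \<and> (\<forall>t. g (t - T) = g t + v)"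

lemma INF_add_right:
  fixes f :: "'a \<Rightarrow> real"
  assumes "A \<noteq> {}" "bdd_below (f ` A)"
  shows "(INF s\<in>A. f s + c) = (INF s\<in>A. f s) + c"
proof (rule antisym)
  obtain B where B: "\<And>s. s \<in> A \<Longrightarrow> B \<le> f s"
    using assms(2) by (auto simp: bdd_below_def)
  have "(INF s\<in>A. f s + c) - c \<le> (INF s\<in>A. f s)"
  proof (rule cINF_greatest[OF assms(1)])
    fix s assume "s \<in> A"
    then have "(INF s\<in>A. f s + c) \<le> f s + c"
      using B by (intro cINF_lower bdd_belowI2[of _ "B + c"]) auto
    then show "(INF s\<in>A. f s + c) - c \<le> f s" by simp
  qed
  then show "(INF s\<in>A. f s + c) \<le> (INF s\<in>A. f s) + c" by simp
  show "(INF s\<in>A. f s) + c \<le> (INF s\<in>A. f s + c)"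
    by (intro cINF_greatest[OF assms(1)] add_right_mono cINF_lower assms(2))
qed

lemma forward_path_paths0:
  assumes "0 < T" "continuous_on UNIV g"
  shows "forward_path T g \<in> paths0 T"
proof -
  have "continuous_on {0..T} (\<lambda>t. g t - g 0)"
    by (intro continuous_intros continuous_on_subset[OF assms(2)]) simp
  then have "continuous_on {0..T} (forward_path T g)"
    by (rule continuous_on_eq) (simp add: forward_path_def)
  then show ?thesis using assms(1) by (simp add: paths0_def forward_path_def)
qed

lemma backward_path_paths0:
  assumes "0 < T" "continuous_on UNIV g"
  shows "backward_path T g \<in> paths0 T"
proof -
  have "continuous_on UNIV (\<lambda>t. g (- t))"
    by (intro continuous_on_compose2[OF assms(2)] continuous_intros) auto
  then have "forward_path T (\<lambda>t. g (- t)) \<in> paths0 T"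
    by (rule forward_path_paths0[OF assms(1)])
  then show ?thesis by (simp add: forward_path_def backward_path_def)
qed

context
  fixes T :: real assumes T: "0 < T"
begin

lemma continuous_extend_path:
  assumes "continuous_on {0..T} \<eta>"
  shows "continuous_on UNIV (extend_path T \<eta>)"
  unfolding extend_path_def
  by (rule continuous_on_compose2[OF assms]) (use T in \<open>auto intro!: continuous_intros\<close>)

lemma extend_path_eq: "t \<in> {0..T} \<Longrightarrow> extend_path T \<eta> t = \<eta> t"
  by (simp add: extend_path_def)

lemma paths0_eqI:
  "\<xi> \<in> paths0 T \<Longrightarrow> \<eta> \<in> paths0 T \<Longrightarrow> (\<And>t. t \<in> {0..T} \<Longrightarrow> \<xi> t = \<eta> t) \<Longrightarrow> \<xi> = \<eta>"
  by (auto simp: paths0_def intro: extensionalityI)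

lemma extend_path_inj:
  assumes "\<xi> \<in> paths0 T" "\<eta> \<in> paths0 T" "extend_path T \<xi> = extend_path T \<eta>"
  shows "\<xi> = \<eta>"
  using assms extend_path_eq by (metis paths0_eqI)

lemma quasi_extend_shift: "quasi_extend T \<eta> (t - T) = quasi_extend T \<eta> t - \<eta> T"
proof -
  have "(t - T) / T = t / T - 1" using T by (simp add: diff_divide_distrib)
  then have fl: "real_of_int \<lfloor>(t - T) / T\<rfloor> = real_of_int \<lfloor>t / T\<rfloor> - 1"
    by (simp del: diff_divide_distrib)
  show ?thesis unfolding quasi_extend_def fl by (simp add: algebra_simps)
qed

lemma quasi_extend_eq: "\<eta> \<in> paths0 T \<Longrightarrow> t \<in> {0..T} \<Longrightarrow> quasi_extend T \<eta> t = \<eta> t"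
proof (cases "t = T")
  case False
  assume "t \<in> {0..T}"
  with False T have "\<lfloor>t / T\<rfloor> = 0" by (simp add: floor_eq_iff)
  then show ?thesis by (simp add: quasi_extend_def)
qed (use T in \<open>simp add: quasi_extend_def paths0_def\<close>)

lemma continuous_quasi_extend:
  assumes \<eta>: "\<eta> \<in> paths0 T"
  shows "continuous_on UNIV (quasi_extend T \<eta>)"
proof -
  have ext: "continuous_on UNIV (extend_path T \<eta>)"
    using \<eta> by (intro continuous_extend_path) (simp add: paths0_def)
  have "isCont (quasi_extend T \<eta>) t" for t
  proof -
    define k where "k = real_of_int \<lfloor>t / T\<rfloor>"
    \<comment> \<open>Near \<open>t\<close> at most two periods matter, and one of the two clamped summands is constant.\<close>
    define f where "f s = extend_path T \<eta> (s - (k - 1) * T) + extend_path T \<eta> (s - k * T) + (k - 1) *\<^sub>R \<eta> T" for s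
    let ?I = "{(k - 1) * T <..< (k + 1) * T}"
    have "k \<le> t / T" "t / T < k + 1" unfolding k_def by linarith+
    then have t: "t \<in> ?I" using T by (auto simp: field_simps)
    have eq: "quasi_extend T \<eta> s = f s" if s: "s \<in> ?I" for s
    proof (cases "s < k * T")
      case True
      have "\<lfloor>s / T\<rfloor> = \<lfloor>t / T\<rfloor> - 1"
        by (rule floor_unique) (use s T True in \<open>simp_all add: k_def field_simps\<close>)
      then have fl: "real_of_int \<lfloor>s / T\<rfloor> = k - 1" by (simp add: k_def)
      show ?thesis using True s \<eta> unfolding quasi_extend_def fl
        by (simp add: f_def quasi_extend_def extend_path_def paths0_def algebra_simps min_def max_def)
    next
      case False
      have "\<lfloor>s / T\<rfloor> = \<lfloor>t / T\<rfloor>"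
        by (rule floor_unique) (use s T False in \<open>simp_all add: k_def field_simps\<close>)
      then have fl: "real_of_int \<lfloor>s / T\<rfloor> = k" by (simp add: k_def)
      show ?thesis using False s \<eta> unfolding quasi_extend_def fl
        by (simp add: f_def quasi_extend_def extend_path_def paths0_def algebra_simps min_def max_def)
    qed
    have "continuous_on UNIV f"
      unfolding f_def by (intro continuous_intros continuous_on_compose2[OF ext]) auto
    then have "isCont f t" by (simp add: continuous_on_eq_continuous_at)
    moreover have "eventually (\<lambda>s. quasi_extend T \<eta> s = f s) (nhds t)"
      using eventually_nhds_in_open[OF open_greaterThanLessThan t] eq by (auto elim: eventually_mono)
    ultimately show ?thesis by (simp add: isCont_cong)
  qed
  then show ?thesis by (simp add: continuous_on_eq_continuous_at)
qed

text \<open>A time \<open>s \<le> t\<close> is moved by whole periods into the window of length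
  \<open>T\<close> ending at \<open>t\<close>; each move forward lowers the pairing by
  \<open>av v \<ge> 0\<close>, so the minimum over this window bounds it below.\<close>

lemma quasi_periodic_bdd:
  assumes "quasi_periodic T v g" "bounded_linear av" "0 \<le> av v"
  shows "bdd_past (\<lambda>s. av (g s))"
proof -
  interpret bounded_linear av by fact
  let ?z = "\<lambda>s. av (g s)"
  have c: "continuous_on UNIV ?z"
    using assms(1) by (intro continuous_on) (simp add: quasi_periodic_def)
  have shift: "?z (s - real n * T) = ?z s + real n * av v" for s n
  proof (induction n)
    case (Suc n)
    have "?z (s - real (Suc n) * T) = ?z ((s - real n * T) - T)" by (simp add: algebra_simps)
    also have "\<dots> = ?z (s - real n * T) + av v" using assms(1) by (simp add: quasi_periodic_def add)
    finally show ?case using Suc by (simp add: algebra_simps)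
  qed simp
  show ?thesis unfolding bdd_past_def
  proof
    fix t
    have "\<exists>u\<in>{t - T..t}. \<forall>s\<in>{t - T..t}. ?z u \<le> ?z s"
      using T by (intro continuous_attains_inf continuous_on_subset[OF c]) auto
    then obtain u where u: "\<And>s. s \<in> {t - T..t} \<Longrightarrow> ?z u \<le> ?z s" by blast
    have "?z u \<le> ?z s" if "s \<le> t" for s
    proof -
      define n where "n = nat \<lfloor>(t - s) / T\<rfloor>"
      have "0 \<le> (t - s) / T" using that T by simp
      then have n: "real n = real_of_int \<lfloor>(t - s) / T\<rfloor>" by (simp add: n_def)
      then have "real n \<le> (t - s) / T" "(t - s) / T < real n + 1" by linarith+
      then have "s + real n * T \<in> {t - T..t}" using T by (auto simp: field_simps)
      then have "?z u \<le> ?z (s + real n * T)" by (rule u)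
      also have "\<dots> \<le> ?z s" using shift[of "s + real n * T" n] assms(3) by simp
      finally show ?thesis .
    qed
    then show "bdd_below (?z ` {..t})" by (intro bdd_belowI2[of _ "?z u"]) auto
  qed
qed

end

section \<open>The transform and the path operator of a single root\<close>

locale coroot =
  fixes a :: "'v::real_normed_vector" and av :: "'v \<Rightarrow> real" and T :: real
  assumes av: "bounded_linear av" and av_a: "av a = 2" and T: "0 < T"
begin

sublocale av: bounded_linear av by (rule av)

lemma bdd_past_extend_path:
  assumes "\<eta> \<in> paths0 T"
  shows "bdd_past (\<lambda>s. av (extend_path T \<eta> s))"
proof -
  have "continuous_on {0..T} (\<lambda>s. av (\<eta> s))"
    using assms by (intro av.continuous_on) (simp add: paths0_def)
  then have "\<exists>u\<in>{0..T}. \<forall>s\<in>{0..T}. av (\<eta> u) \<le> av (\<eta> s)"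
    using T by (intro continuous_attains_inf) auto
  then obtain u where "\<And>s. s \<in> {0..T} \<Longrightarrow> av (\<eta> u) \<le> av (\<eta> s)" by blast
  then show ?thesis using T
    by (intro bdd_pastI[of "\<lambda>_. av (\<eta> u)"]) (simp add: extend_path_def)
qed

text \<open>The extension is constant before \<open>0\<close> and after \<open>T\<close>, so its
  values up to \<open>t\<close> are those on the interval from \<open>0\<close> to the clamped
  time.\<close>

lemma extend_path_pitman: "extend_path T (pitman T a av \<eta>) = line_pitman a av (extend_path T \<eta>)"
proof
  fix t
  define u where "u = min T (max 0 t)"
  have u: "u \<in> {0..T}" using T by (auto simp: u_def)
  have "(\<lambda>s. av (extend_path T \<eta> s)) ` {..t} = (\<lambda>s. av (\<eta> s)) ` {0..u}"
  proof safe
    fix s assume "s \<le> t"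
    then show "av (extend_path T \<eta> s) \<in> (\<lambda>s. av (\<eta> s)) ` {0..u}"
      using T by (intro image_eqI[of _ _ "min T (max 0 s)"]) (auto simp: extend_path_def u_def)
  next
    fix s assume s: "s \<in> {0..u}"
    show "av (\<eta> s) \<in> (\<lambda>s. av (extend_path T \<eta> s)) ` {..t}"
      using s T by (cases "t < 0") (auto simp: extend_path_def u_def intro!: image_eqI[of _ _ "min t s"])
  qed
  then show "extend_path T (pitman T a av \<eta>) t = line_pitman a av (extend_path T \<eta>) t"
    using u by (simp add: extend_path_def[of T "pitman T a av \<eta>"] u_def[symmetric] pitman_def line_pitman_def past_inf_def)
      (simp add: extend_path_def u_def)
qed

lemma pitman_paths0:
  assumes "\<eta> \<in> paths0 T"
  shows "pitman T a av \<eta> \<in> paths0 T"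
proof -
  let ?g = "line_pitman a av (extend_path T \<eta>)"
  have e: "continuous_on UNIV (extend_path T \<eta>)"
    using assms by (intro continuous_extend_path T) (simp add: paths0_def)
  have "continuous_on UNIV ?g"
    by (intro continuous_line_pitman av e bdd_past_extend_path assms)
  then have "continuous_on {0..T} ?g" by (rule continuous_on_subset) simp
  moreover have "?g t = pitman T a av \<eta> t" if "t \<in> {0..T}" for t
    using that extend_path_pitman[of \<eta>] by (metis T extend_path_eq)
  ultimately have "continuous_on {0..T} (pitman T a av \<eta>)"
    by (rule continuous_on_eq)
  then show ?thesis
    using assms T by (simp add: paths0_def pitman_def av.zero)
qed

text \<open>The running infimum is at most both \<open>0\<close> and the current pairing, so the
  pairing of the transformed path is nonnegative; it vanishes for times \<open>\<le> 0\<close>, so a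
  second transform subtracts zero.\<close>

lemma pitman_idem:
  assumes "\<eta> \<in> paths0 T"
  shows "pitman T a av (pitman T a av \<eta>) = pitman T a av \<eta>"
proof (rule extend_path_inj[OF T])
  let ?g = "extend_path T \<eta>"
  let ?z = "\<lambda>s. av (?g s)"
  have bdd: "bdd_past ?z" by (rule bdd_past_extend_path[OF assms])
  have neg: "?z s = 0" if "s \<le> 0" for s
    using that assms T by (simp add: extend_path_def paths0_def av.zero)
  have neg': "past_inf ?z s = 0" if "s \<le> 0" for s
    using that neg by (simp add: past_inf_def cong: INF_cong_simp)
  have z': "av (line_pitman a av ?g s) = ?z s - 2 * past_inf ?z s" for s
    by (simp add: line_pitman_def av.diff av.scale av_a)
  have "past_inf (\<lambda>s. ?z s - 2 * past_inf ?z s) t = 0" for t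
  proof (rule antisym)
    have ge: "0 \<le> ?z s - 2 * past_inf ?z s" for s
      using past_inf_le[OF bdd, of s s] past_inf_le[OF bdd, of "min s 0" s] neg[of "min s 0"] by auto
    then show "0 \<le> past_inf (\<lambda>s. ?z s - 2 * past_inf ?z s) t" by (rule past_inf_greatest)
    have "past_inf (\<lambda>s. ?z s - 2 * past_inf ?z s) t \<le> ?z (min t 0) - 2 * past_inf ?z (min t 0)"
      by (rule past_inf_le) (use ge in \<open>auto intro: bdd_pastI[of "\<lambda>_. 0"]\<close>)
    then show "past_inf (\<lambda>s. ?z s - 2 * past_inf ?z s) t \<le> 0"
      using neg[of "min t 0"] neg'[of "min t 0"] by simp
  qed
  then have "line_pitman a av (line_pitman a av ?g) = line_pitman a av ?g"
    by (subst line_pitman_def) (simp add: z')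
  then show "extend_path T (pitman T a av (pitman T a av \<eta>)) = extend_path T (pitman T a av \<eta>)"
    by (simp add: extend_path_pitman)
qed (intro pitman_paths0 assms)+

text \<open>If the infimum of \<open>y\<close> at \<open>t\<close> exceeded that of
  \<open>z\<close>, then \<open>y\<close> would have to fall after \<open>t\<close>, as the infima
  agree at \<open>T\<close>. At the time \<open>s\<close> where it comes down to its old infimum,
  \<open>y - 2 * past_inf y\<close> equals \<open>- past_inf y t\<close>; written with
  \<open>z\<close>, the same function is at least \<open>- past_inf z t\<close> there, which is
  larger.\<close>

lemma past_inf_determined:
  assumes "continuous_on UNIV y" "bdd_past y" "bdd_past z"
    and "\<And>s. y s - 2 * past_inf y s = z s - 2 * past_inf z s"
    and "past_inf y T = past_inf z T" "t \<le> T"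
  shows "past_inf y t \<le> past_inf z t"
proof (rule ccontr)
  assume "\<not> ?thesis"
  moreover have "past_inf z T \<le> past_inf z t" by (intro past_inf_antimono assms)
  ultimately have "past_inf y T < past_inf y t" using assms(5) by simp
  then obtain s where s: "s \<in> {t..T}" "y s = past_inf y t" "past_inf y s = past_inf y t"
    using past_inf_hit[OF assms(1,2,6)] by blast
  have "past_inf z s \<le> z s" "past_inf z s \<le> past_inf z t"
    using s(1) assms by (auto intro: past_inf_le past_inf_antimono)
  with s assms(4)[of s] \<open>\<not> ?thesis\<close> show False by simp
qed

text \<open>Pairing the equal transforms with \<open>av\<close> makes
  \<open>past_inf_determined\<close> applicable in both directions, so the subtracted multiples of
  \<open>a\<close> agree. This is the uniqueness behind the description in
  \<open>littelmann\<close>.\<close>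

lemma pitman_inj:
  assumes "\<xi> \<in> paths0 T" "\<eta> \<in> paths0 T" "pitman T a av \<xi> = pitman T a av \<eta>" "\<xi> T = \<eta> T"
  shows "\<xi> = \<eta>"
proof (rule paths0_eqI[OF T assms(1,2)])
  let ?x = "extend_path T \<xi>" and ?e = "extend_path T \<eta>"
  let ?y = "\<lambda>s. av (?x s)" and ?z = "\<lambda>s. av (?e s)"
  have eq: "?x s - past_inf ?y s *\<^sub>R a = ?e s - past_inf ?z s *\<^sub>R a" for s
    using arg_cong[OF assms(3), of "extend_path T"] unfolding extend_path_pitman line_pitman_def
    by (rule fun_cong)
  have 1: "?y s - 2 * past_inf ?y s = ?z s - 2 * past_inf ?z s" for s
    using arg_cong[OF eq[of s], of av] by (simp add: av.diff av.scale av_a)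
  have 2: "past_inf ?y T = past_inf ?z T"
    using 1[of T] assms(4) T by (simp add: extend_path_eq)
  have c: "continuous_on UNIV ?y" "continuous_on UNIV ?z"
    using assms(1,2) T by (auto simp: paths0_def intro!: av.continuous_on continuous_extend_path)
  fix t assume "t \<in> {0..T}"
  moreover from this have "past_inf ?y t = past_inf ?z t"
    using past_inf_determined[of ?y ?z t] past_inf_determined[of ?z ?y t] c 1 2
      bdd_past_extend_path[OF assms(1)] bdd_past_extend_path[OF assms(2)] by fastforce
  ultimately show "\<xi> t = \<eta> t" using eq[of t] T by (simp add: extend_path_eq)
qed

lemma simple_path_op_eqI:
  assumes "\<xi> \<in> paths0 T" "\<eta> \<in> paths0 T" "pitman T a av \<xi> = pitman T a av \<eta>"
    and "\<xi> T = \<eta> T - av (\<eta> T) *\<^sub>R a"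
  shows "simple_path_op T a av \<eta> = \<xi>"
  unfolding simple_path_op_def littelmann_def
  using assms by (intro the_equality) (auto intro: pitman_inj)

context
  fixes g :: "real \<Rightarrow> 'v"
  assumes g: "continuous_on UNIV g" and bdd: "bdd_past (\<lambda>s. av (g s))"
begin

lemma cont_av: "continuous_on UNIV (\<lambda>s. av (g s))"
  by (rule av.continuous_on[OF g])

lemma INF_line_pitman:
  assumes "r \<le> t"
  shows "(INF s\<in>{r..t}. av (line_pitman a av g s) + c) =
    (INF s\<in>{r..t}. av (g s)) - past_inf (\<lambda>s. av (g s)) r - past_inf (\<lambda>s. av (g s)) t + c"
    and "(INF s\<in>{r..t}. av (g s) + c) = (INF s\<in>{r..t}. av (g s)) + c"
proof -
  have bdd_Icc: "bdd_below (f ` {r..t})" if "continuous_on UNIV f" for f :: "real \<Rightarrow> real"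
    by (intro bounded_imp_bdd_below compact_imp_bounded compact_continuous_image)
      (auto intro: continuous_on_subset[OF that])
  show "(INF s\<in>{r..t}. av (line_pitman a av g s) + c) =
    (INF s\<in>{r..t}. av (g s)) - past_inf (\<lambda>s. av (g s)) r - past_inf (\<lambda>s. av (g s)) t + c"
    using INF_reflect[OF cont_av bdd assms] assms
    by (subst INF_add_right)
      (auto simp: line_pitman_def av.diff av.scale av_a mult.commute
        intro!: bdd_Icc continuous_intros continuous_on_past_inf cont_av bdd)
  show "(INF s\<in>{r..t}. av (g s) + c) = (INF s\<in>{r..t}. av (g s)) + c"
    using assms by (subst INF_add_right) (auto intro!: bdd_Icc cont_av)
qed

text \<open>By \<open>INF_reflect\<close> on the interval from \<open>0\<close> to \<open>t\<close>,
  the infimum is lowered by the running infima at both ends; after normalisation at \<open>0\<close>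
  this compensates the multiples of \<open>a\<close> subtracted from the path.\<close>

lemma pitman_forward_path:
  "pitman T a av (forward_path T (line_pitman a av g)) = pitman T a av (forward_path T g)"
proof -
  let ?i = "past_inf (\<lambda>s. av (g s))"
  have eq: "(INF s\<in>{0..t}. av (forward_path T f s)) = (INF s\<in>{0..t}. av (f s) + (- av (f 0)))"
    if "t \<in> {0..T}" for t f
    using that by (intro INF_cong) (auto simp: forward_path_def av.diff)
  show ?thesis
    unfolding pitman_def
  proof (rule restrict_ext)
    fix t assume t: "t \<in> {0..T}"
    have a0: "av (line_pitman a av g 0) = av (g 0) - 2 * ?i 0"
      by (simp add: line_pitman_def av.diff av.scale av_a)
    show "forward_path T (line_pitman a av g) t - (INF s\<in>{0..t}. av (forward_path T (line_pitman a av g) s)) *\<^sub>R a =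
        forward_path T g t - (INF s\<in>{0..t}. av (forward_path T g s)) *\<^sub>R a"
      unfolding eq[OF t] using t
      by (simp only: INF_line_pitman atLeastAtMost_iff a0)
        (simp add: forward_path_def line_pitman_def algebra_simps scaleR_2)
  qed
qed

text \<open>The same cancellation on the interval from \<open>-t\<close> to \<open>0\<close>:
  Pitman's duality is symmetric in its two boundary terms, so it survives time reversal.\<close>

lemma pitman_backward_path:
  "pitman T a av (backward_path T (line_pitman a av g)) = pitman T a av (backward_path T g)"
proof -
  let ?i = "past_inf (\<lambda>s. av (g s))"
  have eq: "(INF s\<in>{0..t}. av (backward_path T f s)) = (INF s\<in>{-t..0}. av (f s) + (- av (f 0)))"
    if "t \<in> {0..T}" for t f
  proof -
    have "{-t..0} = uminus ` {0..t}" by simp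
    then have "(INF s\<in>{-t..0}. av (f s) + (- av (f 0))) = (INF s\<in>{0..t}. av (f (- s)) + (- av (f 0)))"
      by (simp only: image_image)
    also have "\<dots> = (INF s\<in>{0..t}. av (backward_path T f s))"
      using that by (intro INF_cong) (auto simp: backward_path_def av.diff)
    finally show ?thesis by simp
  qed
  show ?thesis
    unfolding pitman_def
  proof (rule restrict_ext)
    fix t assume t: "t \<in> {0..T}"
    then have t': "- t \<le> 0" by simp
    have a0: "av (line_pitman a av g 0) = av (g 0) - 2 * ?i 0"
      by (simp add: line_pitman_def av.diff av.scale av_a)
    show "backward_path T (line_pitman a av g) t - (INF s\<in>{0..t}. av (backward_path T (line_pitman a av g) s)) *\<^sub>R a =
        backward_path T g t - (INF s\<in>{0..t}. av (backward_path T g s)) *\<^sub>R a"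
      unfolding eq[OF t] using t
      by (simp only: INF_line_pitman[OF t'] atLeastAtMost_iff a0)
        (simp add: backward_path_def line_pitman_def algebra_simps scaleR_2)
  qed
qed

end

lemma past_inf_quasi_periodic:
  assumes "quasi_periodic T v g" "0 \<le> av v"
  shows "past_inf (\<lambda>s. av (g s)) (t - T) = past_inf (\<lambda>s. av (g s)) t + av v"
proof (rule antisym)
  let ?z = "\<lambda>s. av (g s)"
  have bdd: "bdd_past ?z" by (rule quasi_periodic_bdd[OF T assms(1) av assms(2)])
  have z: "?z (s - T) = ?z s + av v" for s
    using assms(1) by (simp add: quasi_periodic_def av.add)
  have "past_inf ?z (t - T) - av v \<le> past_inf ?z t"
  proof (rule past_inf_greatest)
    fix s assume "s \<le> t"
    then show "past_inf ?z (t - T) - av v \<le> ?z s"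
      using past_inf_le[OF bdd, of "s - T" "t - T"] z[of s] by simp
  qed
  then show "past_inf ?z (t - T) \<le> past_inf ?z t + av v" by simp
  show "past_inf ?z t + av v \<le> past_inf ?z (t - T)"
  proof (rule past_inf_greatest)
    fix s assume "s \<le> t - T"
    then show "past_inf ?z t + av v \<le> ?z s"
      using past_inf_le[OF bdd, of "s + T" t] z[of "s + T"] by simp
  qed
qed

text \<open>The running infimum itself gains \<open>av v\<close> in a step back, so the increment
  gets reflected in \<open>a\<close>.\<close>

lemma quasi_periodic_line_pitman:
  assumes "quasi_periodic T v g" "0 \<le> av v"
  shows "quasi_periodic T (v - av v *\<^sub>R a) (line_pitman a av g)"
  using assms past_inf_quasi_periodic[OF assms] quasi_periodic_bdd[OF T assms(1) av assms(2)]
    continuous_line_pitman[OF av, of g a]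
  by (simp add: quasi_periodic_def) (simp add: line_pitman_def algebra_simps)

text \<open>The reversed transform has the right \<open>pitman\<close> image, and its endpoint is
  the reflected increment; uniqueness does the rest.\<close>

lemma simple_path_op_backward_path:
  assumes "quasi_periodic T v g" "0 \<le> av v"
  shows "simple_path_op T a av (backward_path T g) = backward_path T (line_pitman a av g)"
proof (rule simple_path_op_eqI)
  note q = quasi_periodic_line_pitman[OF assms]
  note bdd = quasi_periodic_bdd[OF T assms(1) av assms(2)]
  show "backward_path T (line_pitman a av g) \<in> paths0 T" "backward_path T g \<in> paths0 T"
    using q assms by (auto simp: quasi_periodic_def intro: backward_path_paths0 T)
  show "pitman T a av (backward_path T (line_pitman a av g)) = pitman T a av (backward_path T g)"
    using assms bdd by (intro pitman_backward_path) (auto simp: quasi_periodic_def)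
  have "backward_path T f T = w" if "quasi_periodic T w f" for f w
    using that T spec[of "\<lambda>t. f (t - T) = f t + w" 0] by (simp add: backward_path_def quasi_periodic_def)
  from this[OF q] this[OF assms(1)]
  show "backward_path T (line_pitman a av g) T = backward_path T g T - av (backward_path T g T) *\<^sub>R a"
    by simp
qed

lemma quasi_periodic_reverse:
  assumes "\<eta> \<in> paths0 T"
  shows "quasi_periodic T (\<eta> T) (\<lambda>t. quasi_extend T \<eta> (- t))"
    and "backward_path T (\<lambda>t. quasi_extend T \<eta> (- t)) = \<eta>"
proof -
  have c: "continuous_on UNIV (\<lambda>t. quasi_extend T \<eta> (- t))"
    by (intro continuous_on_compose2[OF continuous_quasi_extend[OF T assms]] continuous_intros) auto
  have "quasi_extend T \<eta> (- (t - T)) = quasi_extend T \<eta> (- t) + \<eta> T" for t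
    using quasi_extend_shift[OF T, of \<eta> "T - t"] by simp
  with c show "quasi_periodic T (\<eta> T) (\<lambda>t. quasi_extend T \<eta> (- t))"
    by (simp add: quasi_periodic_def)
  show "backward_path T (\<lambda>t. quasi_extend T \<eta> (- t)) = \<eta>"
    using T assms by (intro paths0_eqI[OF T] backward_path_paths0 c)
      (auto simp: backward_path_def quasi_extend_eq paths0_def[of T])
qed

text \<open>Besides uniqueness, the description needs existence. The sign of
  \<open>av (\<eta> T)\<close> selects the time direction in which the quasi-periodic extension has
  its pairing bounded below on past half-lines; there the line transform supplies the path.\<close>

lemma simple_path_op_paths0:
  assumes \<eta>: "\<eta> \<in> paths0 T"
  defines "\<xi> \<equiv> simple_path_op T a av \<eta>"
  shows "\<xi> \<in> paths0 T \<and> pitman T a av \<xi> = pitman T a av \<eta> \<and> \<xi> T = \<eta> T - av (\<eta> T) *\<^sub>R a"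
proof -
  have "\<exists>\<xi>. \<xi> \<in> paths0 T \<and> pitman T a av \<xi> = pitman T a av \<eta> \<and> \<xi> T = \<eta> T - av (\<eta> T) *\<^sub>R a"
  proof (cases "0 \<le> av (\<eta> T)")
    case True
    let ?g = "\<lambda>t. quasi_extend T \<eta> (- t)"
    note g = quasi_periodic_reverse[OF \<eta>]
    note bdd = quasi_periodic_bdd[OF T g(1) av True]
    have q: "quasi_periodic T (\<eta> T - av (\<eta> T) *\<^sub>R a) (line_pitman a av ?g)"
      by (rule quasi_periodic_line_pitman[OF g(1) True])
    have "backward_path T (line_pitman a av ?g) T = \<eta> T - av (\<eta> T) *\<^sub>R a"
      using q T spec[of "\<lambda>t. line_pitman a av ?g (t - T) = line_pitman a av ?g t + (\<eta> T - av (\<eta> T) *\<^sub>R a)" 0]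
      by (simp add: backward_path_def quasi_periodic_def)
    moreover have "pitman T a av (backward_path T (line_pitman a av ?g)) = pitman T a av \<eta>"
      using pitman_backward_path[of ?g] g bdd by (simp add: quasi_periodic_def)
    ultimately show ?thesis
      using q by (intro exI[of _ "backward_path T (line_pitman a av ?g)"])
        (auto simp: quasi_periodic_def intro!: backward_path_paths0 T)
  next
    case False
    let ?g = "quasi_extend T \<eta>"
    have g: "quasi_periodic T (- \<eta> T) ?g"
      using continuous_quasi_extend[OF T \<eta>] by (simp add: quasi_periodic_def quasi_extend_shift[OF T])
    have neg: "0 \<le> av (- \<eta> T)" using False by (simp add: av.neg)
    note bdd = quasi_periodic_bdd[OF T g av neg]
    have q: "quasi_periodic T (- \<eta> T - av (- \<eta> T) *\<^sub>R a) (line_pitman a av ?g)"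
      by (rule quasi_periodic_line_pitman[OF g neg])
    have "forward_path T (line_pitman a av ?g) T = \<eta> T - av (\<eta> T) *\<^sub>R a"
      using q T spec[of "\<lambda>t. line_pitman a av ?g (t - T) = line_pitman a av ?g t + (- \<eta> T - av (- \<eta> T) *\<^sub>R a)" T]
      by (simp add: forward_path_def quasi_periodic_def av.neg algebra_simps)
    moreover have "forward_path T ?g = \<eta>"
      using T \<eta> by (intro paths0_eqI[OF T] forward_path_paths0 continuous_quasi_extend)
        (auto simp: forward_path_def quasi_extend_eq paths0_def[of T])
    then have "pitman T a av (forward_path T (line_pitman a av ?g)) = pitman T a av \<eta>"
      using pitman_forward_path[of ?g] g bdd by (simp add: quasi_periodic_def)
    ultimately show ?thesis
      using q by (intro exI[of _ "forward_path T (line_pitman a av ?g)"])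
        (auto simp: quasi_periodic_def intro!: forward_path_paths0 T)
  qed
  then show ?thesis
    using simple_path_op_eqI[OF _ \<eta>] by (auto simp: \<xi>_def)
qed

lemma simple_path_op_involution:
  assumes "\<eta> \<in> paths0 T"
  shows "simple_path_op T a av (simple_path_op T a av \<eta>) = \<eta>"
proof -
  let ?\<xi> = "simple_path_op T a av \<eta>"
  have \<xi>: "?\<xi> \<in> paths0 T" "pitman T a av ?\<xi> = pitman T a av \<eta>" "?\<xi> T = \<eta> T - av (\<eta> T) *\<^sub>R a"
    using simple_path_op_paths0[OF assms] by auto
  have "av (?\<xi> T) = - av (\<eta> T)" by (simp add: \<xi>(3) av.diff av.scale av_a)
  with \<xi> assms show ?thesis by (intro simple_path_op_eqI) auto
qed

end

section \<open>The dihedral relation for the operators on paths\<close>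

lemma alternate_add:
  "alternate f h (n + k) = alternate f h n \<circ> (if even n then alternate f h k else alternate h f k)"
  by (induction n arbitrary: f h) (auto simp: comp_assoc)

lemma alternate_intertwine:
  assumes "\<And>x. e (f x) = f' (e x)" "\<And>x. e (h x) = h' (e x)"
  shows "e (alternate f h n x) = alternate f' h' n (e x)"
  using assms by (induction n arbitrary: f h f' h') auto

definition involutive_on :: "'a set \<Rightarrow> ('a \<Rightarrow> 'a) \<Rightarrow> bool" where
  "involutive_on X f \<longleftrightarrow> (\<forall>x\<in>X. f x \<in> X \<and> f (f x) = x)"

lemma alternate_closed:
  "f \<in> X \<rightarrow> X \<Longrightarrow> h \<in> X \<rightarrow> X \<Longrightarrow> x \<in> X \<Longrightarrow> alternate f h n x \<in> X"
  by (induction n arbitrary: f h) auto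

lemma alternate_cancel:
  assumes "involutive_on X f" "involutive_on X h" "x \<in> X"
  shows "(if even n then alternate h f n else alternate f h n) (alternate f h n x) = x"
  using assms(3)
proof (induction n arbitrary: x)
  case (Suc n)
  have "f x \<in> X" "h x \<in> X" "f (f x) = x" "h (h x) = x"
    using Suc.prems assms(1,2) by (auto simp: involutive_on_def)
  with Suc.IH[of "f x"] Suc.IH[of "h x"] show ?case
    by (subst alternate_Suc_right) (auto split: if_splits)
qed simp

text \<open>In the word of length \<open>2 * m\<close> the inner half is replaced, at
  \<open>x\<close>, by the other alternating word, which the outer half undoes letter by
  letter.\<close>

lemma alternate_double_fixed:
  assumes "involutive_on X f" "involutive_on X h" "x \<in> X"
    and "alternate f h m x = alternate h f m x"
  shows "alternate f h (2 * m) x = x"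
  using alternate_cancel[OF assms(1,2,3), of m] alternate_cancel[OF assms(2,1,3), of m] assms(4)
  unfolding mult_2 alternate_add by (auto split: if_splits)

text \<open>Conjugation by \<open>f\<close> exchanges the two orders of the word, so the relation at
  \<open>f x\<close> in one order gives that at \<open>x\<close> in the other; hence both are
  carried along.\<close>

lemma alternate_double_fixed_step:
  assumes "involutive_on X f" "involutive_on X h" "x \<in> X" "0 < m"
    and "alternate f h (2 * m) (f x) = f x" "alternate h f (2 * m) (f x) = f x"
  shows "alternate f h (2 * m) x = x" "alternate h f (2 * m) x = x"
proof -
  obtain j where "m = Suc j" using assms(4) by (cases m) auto
  then obtain n where n: "2 * m = Suc n" "odd n" by simp
  have X: "f x \<in> X" "f (f x) = x" using assms(1,3) by (auto simp: involutive_on_def)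
  have "alternate h f (2 * m) (f x) = alternate h f n x"
    unfolding n(1) alternate_Suc_right using n(2) X by simp
  then show "alternate f h (2 * m) x = x"
    using assms(6) X by (simp add: n(1))
  have fX: "f \<in> X \<rightarrow> X" "h \<in> X \<rightarrow> X" using assms(1,2) by (auto simp: involutive_on_def)
  have Y: "alternate h f n (f x) \<in> X" using fX X by (intro alternate_closed) auto
  have "f (alternate h f n (f x)) = f x" using assms(5) by (simp add: n(1))
  then have "f (f (alternate h f n (f x))) = f (f x)" by simp
  then have "alternate h f n (f x) = x"
    using Y X(2) assms(1) by (simp add: involutive_on_def)
  then show "alternate h f (2 * m) x = x"
    unfolding n(1) alternate_Suc_right using n(2) by simp
qed

lemma (in coroot) simple_path_op_involutive: "involutive_on (paths0 T) (simple_path_op T a av)"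
  using simple_path_op_paths0 simple_path_op_involution by (auto simp: involutive_on_def)

section \<open>The rank-two relations on paths\<close>

locale dihedral_paths = dihedral_roots +
  fixes T :: real assumes T: "0 < T"
begin

sublocale a: coroot a av T
  using av av_a T by unfold_locales (auto simp: bounded_linear_def bounded_linear_axioms_def)

sublocale b: coroot b bv T
  using bv bv_b T by unfold_locales

lemma pitman_braid:
  assumes "\<eta> \<in> paths0 T"
  shows "alternate (pitman T a av) (pitman T b bv) m \<eta> = alternate (pitman T b bv) (pitman T a av) m \<eta>"
proof (rule extend_path_inj[OF T])
  have P: "pitman T a av \<in> paths0 T \<rightarrow> paths0 T" "pitman T b bv \<in> paths0 T \<rightarrow> paths0 T"
    using a.pitman_paths0 b.pitman_paths0 by auto
  show "alternate (pitman T a av) (pitman T b bv) m \<eta> \<in> paths0 T"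
    "alternate (pitman T b bv) (pitman T a av) m \<eta> \<in> paths0 T"
    using P assms by (auto intro: alternate_closed)
  note i = alternate_intertwine[of "extend_path T", where f' = "line_pitman a av" and h' = "line_pitman b bv"]
    alternate_intertwine[of "extend_path T", where f' = "line_pitman b bv" and h' = "line_pitman a av"]
  have "alternate (line_pitman a av) (line_pitman b bv) m (extend_path T \<eta>) =
      alternate (line_pitman b bv) (line_pitman a av) m (extend_path T \<eta>)"
    using assms by (intro line_pitman_braid continuous_extend_path T a.bdd_past_extend_path b.bdd_past_extend_path)
      (auto simp: paths0_def)
  then show "extend_path T (alternate (pitman T a av) (pitman T b bv) m \<eta>) =
      extend_path T (alternate (pitman T b bv) (pitman T a av) m \<eta>)"
    by (simp add: i a.extend_path_pitman b.extend_path_pitman)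
qed

abbreviation "ra \<equiv> \<lambda>v. v - av v *\<^sub>R a"
abbreviation "rb \<equiv> \<lambda>v. v - bv v *\<^sub>R b"

text \<open>The weights are the coordinates of the coroots of the dihedral group in the two simple
  ones, and both sides obey the same three-term recursion. The \<open>case\<close> expression stands
  for the weight of index \<open>-1\<close>, which is zero.\<close>

lemma alternate_reflection:
  "av (alternate rb ra n v) = U n * (if even n then av v else bv v)
     + (case n of 0 \<Rightarrow> 0 | Suc k \<Rightarrow> U k) * (if even n then bv v else av v) \<and>
   bv (alternate ra rb n v) = U n * (if even n then bv v else av v)
     + (case n of 0 \<Rightarrow> 0 | Suc k \<Rightarrow> U k) * (if even n then av v else bv v)"
proof (induction n rule: induct_nat_012)
  case 0
  then show ?case using m by (simp add: dihedral_weight_0)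
next
  case 1
  then show ?case
    using m by (simp add: dihedral_weight_0 dihedral_weight_1 av.diff bv.diff av.scale bv.scale av_b bv_a)
next
  case (ge2 n)
  define c where "c = 2 * cos (pi / real m)"
  have rec: "av (alternate rb ra (Suc (Suc n)) v) = c * bv (alternate ra rb (Suc n) v) - av (alternate rb ra n v)"
    "bv (alternate ra rb (Suc (Suc n)) v) = c * av (alternate rb ra (Suc n) v) - bv (alternate ra rb n v)"
    by (simp_all add: c_def av.diff bv.diff av.scale bv.scale av_a av_b bv_a bv_b)
  define W where "W = (case n of 0 \<Rightarrow> 0 | Suc k \<Rightarrow> U k)"
  have U2: "U (Suc (Suc n)) = U (Suc n) * c - U n"
    using dihedral_weight_Suc[of m n] by (simp add: c_def)
  have U1: "U (Suc n) = U n * c - W"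
    using dihedral_weight_Suc[of m "n - 1"] m
    by (cases n) (simp_all add: W_def c_def dihedral_weight_0 dihedral_weight_1)
  show ?case
    unfolding rec ge2(1)[THEN conjunct1] ge2(1)[THEN conjunct2] ge2(2)[THEN conjunct1] ge2(2)[THEN conjunct2]
      W_def[symmetric]
    by (simp add: U2 U1 algebra_simps del: alternate.simps)
qed

lemma alternate_reflection_nonneg:
  assumes "0 \<le> av v" "0 \<le> bv v" "n < m"
  shows "0 \<le> av (alternate rb ra n v)" "0 \<le> bv (alternate ra rb n v)"
  using alternate_reflection[of n v] assms dihedral_weight_nonneg[OF m, of n] dihedral_weight_nonneg[OF m, of "n - 1"]
  by (cases n; simp del: alternate.simps)+

text \<open>Each use of \<open>simple_path_op_backward_path\<close> needs an increment with
  nonnegative pairing against the next coroot; starting from a dominant increment this holds for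
  \<open>m\<close> steps, by \<open>alternate_reflection_nonneg\<close>.\<close>

lemma alternate_simple_path_op:
  fixes g defines "Sa \<equiv> simple_path_op T a av" and "Sb \<equiv> simple_path_op T b bv"
    and "Pa \<equiv> line_pitman a av" and "Pb \<equiv> line_pitman b bv"
  assumes g: "quasi_periodic T v g" and v: "0 \<le> av v" "0 \<le> bv v"
  shows "n \<le> m \<Longrightarrow>
    (quasi_periodic T (alternate ra rb n v) (alternate Pa Pb n g) \<and>
      alternate Sa Sb n (backward_path T g) = backward_path T (alternate Pa Pb n g)) \<and>
    (quasi_periodic T (alternate rb ra n v) (alternate Pb Pa n g) \<and>
      alternate Sb Sa n (backward_path T g) = backward_path T (alternate Pb Pa n g))"
proof (induction n)
  case (Suc n)
  then have nn: "0 \<le> av (alternate rb ra n v)" "0 \<le> bv (alternate ra rb n v)"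
    using alternate_reflection_nonneg[OF v, of n] by auto
  from Suc have IH: "quasi_periodic T (alternate ra rb n v) (alternate Pa Pb n g)"
    "quasi_periodic T (alternate rb ra n v) (alternate Pb Pa n g)"
    "alternate Sa Sb n (backward_path T g) = backward_path T (alternate Pa Pb n g)"
    "alternate Sb Sa n (backward_path T g) = backward_path T (alternate Pb Pa n g)" by auto
  show ?case
    using a.quasi_periodic_line_pitman[OF IH(2) nn(1)] b.quasi_periodic_line_pitman[OF IH(1) nn(2)]
      a.simple_path_op_backward_path[OF IH(2) nn(1)] b.simple_path_op_backward_path[OF IH(1) nn(2)]
    by (simp add: IH(3,4) Sa_def[symmetric] Sb_def[symmetric] Pa_def[symmetric] Pb_def[symmetric])
qed (use g in simp)

definition relation_fixed :: "(real \<Rightarrow> 'a) set" where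
  "relation_fixed = {\<eta> \<in> paths0 T.
     alternate (simple_path_op T a av) (simple_path_op T b bv) (2 * m) \<eta> = \<eta> \<and>
     alternate (simple_path_op T b bv) (simple_path_op T a av) (2 * m) \<eta> = \<eta>}"

text \<open>The reversed extension has increment \<open>\<eta> T\<close>; dominance bounds both
  pairings, so the braid relation on the line becomes one at \<open>\<eta>\<close>.\<close>

lemma relation_fixed_dominant:
  assumes \<eta>: "\<eta> \<in> paths0 T" and v: "0 \<le> av (\<eta> T)" "0 \<le> bv (\<eta> T)"
  shows "\<eta> \<in> relation_fixed"
proof -
  let ?g = "\<lambda>t. quasi_extend T \<eta> (- t)"
  note g = a.quasi_periodic_reverse[OF \<eta>]
  have "alternate (line_pitman a av) (line_pitman b bv) m ?g = alternate (line_pitman b bv) (line_pitman a av) m ?g"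
    using g(1) quasi_periodic_bdd[OF T g(1) av v(1)] quasi_periodic_bdd[OF T g(1) bv v(2)]
    by (intro line_pitman_braid) (auto simp: quasi_periodic_def)
  then have "alternate (simple_path_op T a av) (simple_path_op T b bv) m \<eta> =
      alternate (simple_path_op T b bv) (simple_path_op T a av) m \<eta>"
    using alternate_simple_path_op[OF g(1) v, of m] unfolding g(2) by simp
  then show ?thesis
    using \<eta> alternate_double_fixed[OF a.simple_path_op_involutive b.simple_path_op_involutive \<eta>, of m]
      alternate_double_fixed[OF b.simple_path_op_involutive a.simple_path_op_involutive \<eta>, of m]
    by (simp add: relation_fixed_def)
qed

lemma relation_fixed_step:
  assumes "\<eta> \<in> paths0 T" "simple_path_op T a av \<eta> \<in> relation_fixed \<or> simple_path_op T b bv \<eta> \<in> relation_fixed"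
  shows "\<eta> \<in> relation_fixed"
  using assms(2)
proof
  assume "simple_path_op T a av \<eta> \<in> relation_fixed"
  then show ?thesis
    using alternate_double_fixed_step[OF a.simple_path_op_involutive b.simple_path_op_involutive assms(1), of m] m assms(1)
    by (simp add: relation_fixed_def)
next
  assume "simple_path_op T b bv \<eta> \<in> relation_fixed"
  then show ?thesis
    using alternate_double_fixed_step[OF b.simple_path_op_involutive a.simple_path_op_involutive assms(1), of m] m assms(1)
    by (simp add: relation_fixed_def)
qed

end

section \<open>The exchange condition and Matsumoto's theorem\<close>

fun alternating :: "'a \<Rightarrow> 'a \<Rightarrow> nat \<Rightarrow> 'a list" where
  "alternating s t 0 = []"
| "alternating s t (Suc n) = s # alternating t s n"

lemma length_alternating [simp]: "length (alternating s t n) = n"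
  by (induction n arbitrary: s t) auto

lemma set_alternating: "set (alternating s t n) \<subseteq> {s, t}"
  by (induction n arbitrary: s t) auto

lemma concat_replicate_alternating: "concat (replicate n [s, t]) = alternating s t (2 * n)"
  by (induction n) auto

section \<open>Words, lengths and alternating words\<close>

context coxeter_system
begin

abbreviation "wp \<equiv> word_prod W"

lemma word_prod_Nil [simp]: "wp [] = \<one>"
  and word_prod_Cons [simp]: "wp (s # us) = s \<otimes> wp us"
  by (simp_all add: word_prod_def)

lemma gen_closed [simp]: "s \<in> S \<Longrightarrow> s \<in> carrier W"
  using gens_closed by auto

lemma word_prod_closed [simp]: "us \<in> lists S \<Longrightarrow> wp us \<in> carrier W"
  by (induction us) auto

lemma word_prod_append: "us \<in> lists S \<Longrightarrow> vs \<in> lists S \<Longrightarrow> wp (us @ vs) = wp us \<otimes> wp vs"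
  by (induction us) (auto simp: m_assoc)

lemma gen_square [simp]: "s \<in> S \<Longrightarrow> s \<otimes> s = \<one>"
  using gens_involution by auto

lemma inv_gen [simp]: "s \<in> S \<Longrightarrow> inv s = s"
  by (simp add: inv_equality)

lemma gen_mult_cancel [simp]: "s \<in> S \<Longrightarrow> x \<in> carrier W \<Longrightarrow> s \<otimes> (s \<otimes> x) = x"
  by (simp add: m_assoc[symmetric])

lemma word_prod_rev: "us \<in> lists S \<Longrightarrow> wp (rev us) = inv (wp us)"
proof (induction us)
  case (Cons s us)
  then have "rev us \<in> lists S" by (auto simp: in_lists_conv_set)
  with Cons show ?case by (simp add: word_prod_append inv_mult_group)
qed simp

lemma word_prod_surj:
  assumes "w \<in> carrier W"
  shows "\<exists>us\<in>lists S. wp us = w"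
proof -
  have "w \<in> generate W S" using assms gens_generate by simp
  then show ?thesis
  proof (induction rule: generate.induct)
    case one
    then show ?case by (intro bexI[of _ "[]"]) auto
  next
    case (incl h)
    then show ?case by (intro bexI[of _ "[h]"]) auto
  next
    case (inv h)
    then show ?case by (intro bexI[of _ "[h]"]) auto
  next
    case (eng g h)
    then obtain us vs where "us \<in> lists S" "wp us = g" "vs \<in> lists S" "wp vs = h" by blast
    then show ?case by (intro bexI[of _ "us @ vs"]) (auto simp: word_prod_append)
  qed
qed

lemma alternating_lists [simp]: "s \<in> S \<Longrightarrow> t \<in> S \<Longrightarrow> alternating s t n \<in> lists S"
  using set_alternating[of s t n] by auto

lemma word_prod_alternating_even:
  assumes "s \<in> S" "t \<in> S"
  shows "wp (alternating s t (2 * n)) = (s \<otimes> t) [^] n"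
proof (induction n)
  case (Suc n)
  have "(s \<otimes> t) [^] Suc n = (s \<otimes> t) \<otimes> (s \<otimes> t) [^] n"
    using assms by (subst nat_pow_Suc2) auto
  with Suc show ?case using assms by (simp add: m_assoc)
qed simp

lemma alternating_snoc: "alternating s t n @ [if even n then s else t] = alternating s t (Suc n)"
  by (induction n arbitrary: s t) auto

lemma rev_alternating: "rev (alternating s t n) = (if even n then alternating t s n else alternating s t n)"
proof (induction n arbitrary: s t)
  case (Suc n)
  show ?case
  proof (cases "even n")
    case True
    then show ?thesis using Suc.IH[of t s] alternating_snoc[of s t n] by simp
  next
    case False
    then have "rev (alternating t s n) = alternating t s n" using Suc.IH[of t s] by simp
    then have "rev (alternating s t (Suc n)) = alternating t s n @ [s]" by simp
    then show ?thesis using False alternating_snoc[of t s n] by (simp del: alternating.simps)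
  qed
qed simp

lemma alternating_add: "alternating s t (n + k) = alternating s t n @ (if even n then alternating s t k else alternating t s k)"
  by (induction n arbitrary: s t) auto

text \<open>Write \<open>(s \<otimes> t) [^] k\<close> as one alternating word. By hypothesis its
  first half can be replaced by the other alternating word of length \<open>k\<close>, which is the
  reversal of the second half, so the product is \<open>\<one>\<close>.\<close>

lemma alternating_eq_imp_ord_dvd:
  assumes "s \<in> S" "t \<in> S" "wp (alternating s t k) = wp (alternating t s k)"
  shows "ord (s \<otimes> t) dvd k"
proof -
  have r: "wp (rev (alternating s t k)) \<otimes> wp (alternating s t k) = \<one>"
    "wp (rev (alternating t s k)) \<otimes> wp (alternating t s k) = \<one>"
    using assms(1,2) by (simp_all add: word_prod_rev)
  have "(s \<otimes> t) [^] k = wp (alternating s t k) \<otimes> wp (if even k then alternating s t k else alternating t s k)"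
    using assms(1,2) by (simp add: word_prod_alternating_even[symmetric] mult_2 alternating_add word_prod_append)
  also have "\<dots> = \<one>"
    using r assms(3) by (auto simp: rev_alternating split: if_splits)
  finally show ?thesis using assms(1,2) by (simp add: pow_eq_id)
qed

lemma gen_ord: "s \<in> S \<Longrightarrow> t \<in> S \<Longrightarrow> s \<noteq> t \<Longrightarrow> ord (s \<otimes> t) \<noteq> 1"
  using ord_eq_1[of "s \<otimes> t"] by (metis gen_closed gen_mult_cancel m_closed r_one)

lemma cox_length_le: "us \<in> lists S \<Longrightarrow> cox_length W S (wp us) \<le> length us"
  unfolding cox_length_def by (rule Least_le) auto

lemma reduced_decomposition_exists:
  assumes "w \<in> carrier W"
  shows "\<exists>us. reduced_decomposition W S w us"
proof -
  have "\<exists>n. \<exists>us\<in>lists S. length us = n \<and> wp us = w"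
    using word_prod_surj[OF assms] by blast
  then have "\<exists>us\<in>lists S. length us = cox_length W S w \<and> wp us = w"
    unfolding cox_length_def by (rule LeastI_ex)
  then show ?thesis by (auto simp: reduced_decomposition_def)
qed

abbreviation is_reduced :: "'g list \<Rightarrow> bool" where "is_reduced us \<equiv> reduced_decomposition W S (wp us) us"

lemma reduced_lists: "is_reduced us \<Longrightarrow> us \<in> lists S"
  by (simp add: reduced_decomposition_def)

lemma reduced_le: "is_reduced us \<Longrightarrow> vs \<in> lists S \<Longrightarrow> wp vs = wp us \<Longrightarrow> length us \<le> length vs"
  using cox_length_le[of vs] by (simp add: reduced_decomposition_def)

lemma reducedI:
  assumes "us \<in> lists S" "\<And>vs. vs \<in> lists S \<Longrightarrow> wp vs = wp us \<Longrightarrow> length us \<le> length vs"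
  shows "is_reduced us"
proof -
  obtain vs where vs: "vs \<in> lists S" "wp vs = wp us" "length vs = cox_length W S (wp us)"
    using reduced_decomposition_exists[OF word_prod_closed[OF assms(1)]]
    unfolding reduced_decomposition_def by blast
  then have "length us = cox_length W S (wp us)"
    using cox_length_le[OF assms(1)] assms(2)[OF vs(1,2)] by simp
  then show ?thesis using assms(1) by (simp add: reduced_decomposition_def)
qed

lemma reduced_transfer:
  "is_reduced us \<Longrightarrow> vs \<in> lists S \<Longrightarrow> wp vs = wp us \<Longrightarrow> length vs \<le> length us \<Longrightarrow> is_reduced vs"
  by (rule reducedI) (auto dest: reduced_le)

lemma reduced_Cons:
  assumes "is_reduced (s # us)"
  shows "is_reduced us"
proof (rule reducedI)
  show "us \<in> lists S" using reduced_lists[OF assms] by simp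
  fix vs assume "vs \<in> lists S" "wp vs = wp us"
  then have "length (s # us) \<le> length (s # vs)"
    using reduced_lists[OF assms] by (intro reduced_le[OF assms]) auto
  then show "length us \<le> length vs" by simp
qed

text \<open>The number of indices \<open>j\<close> with \<open>s1 ... s(j-1) sj s(j-1) ... s1 = r\<close>. Its parity depends only on
  the group element, which yields the exchange condition.\<close>

fun reflection_count :: "'g list \<Rightarrow> 'g \<Rightarrow> nat" where
  "reflection_count [] r = 0"
| "reflection_count (s # us) r = (if r = s then 1 else 0) + reflection_count us (s \<otimes> r \<otimes> s)"

lemma reflection_count_append:
  assumes "us \<in> lists S" "r \<in> carrier W"
  shows "reflection_count (us @ vs) r = reflection_count us r + reflection_count vs (inv (wp us) \<otimes> r \<otimes> wp us)"
  using assms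
proof (induction us arbitrary: r)
  case (Cons s us)
  then show ?case by (simp add: inv_mult_group m_assoc)
qed simp

text \<open>The reflection attached to position \<open>j\<close> of an alternating word is again
  alternating, of length \<open>2 * j + 1\<close>: conjugating by the new leading letter adds a
  letter at each end.\<close>

lemma reflection_count_alternating:
  assumes "s \<in> S" "t \<in> S" "r \<in> carrier W"
  shows "reflection_count (alternating s t n) r = card {j. j < n \<and> r = wp (alternating s t (Suc (2 * j)))}"
  using assms
proof (induction n arbitrary: s t r)
  case (Suc n)
  have conj: "s \<otimes> r \<otimes> s = wp (alternating t s (Suc (2 * j))) \<longleftrightarrow> r = wp (alternating s t (Suc (2 * Suc j)))" for j
  proof -
    let ?x = "wp (alternating t s (Suc (2 * j)))"
    have "alternating s t (Suc (2 * Suc j)) = s # alternating t s (Suc (2 * j)) @ [s]"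
      using alternating_add[of t s "Suc (2 * j)" 1] by simp
    then have eq: "wp (alternating s t (Suc (2 * Suc j))) = s \<otimes> (?x \<otimes> s)"
      using Suc.prems alternating_lists[of t s "Suc (2*j)"]
      by (simp only: word_prod_Cons) (subst word_prod_append, auto)
    have x: "?x \<in> carrier W" using Suc.prems by (intro word_prod_closed alternating_lists)
    have "s \<otimes> ((s \<otimes> r \<otimes> s) \<otimes> s) = r" "s \<otimes> (s \<otimes> (?x \<otimes> s)) \<otimes> s = ?x"
      using Suc.prems x by (simp_all add: m_assoc del: alternating.simps word_prod_Cons)
    then show ?thesis unfolding eq by metis
  qed
  have "{j. j < Suc n \<and> r = wp (alternating s t (Suc (2 * j)))} =
    (if r = s then {0} else {}) \<union> Suc ` {j. j < n \<and> r = wp (alternating s t (Suc (2 * Suc j)))}"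
    using Suc.prems by (auto simp: less_Suc_eq_0_disj image_iff simp del: alternating.simps(2) ) (auto)
  then have "card {j. j < Suc n \<and> r = wp (alternating s t (Suc (2 * j)))} =
    (if r = s then 1 else 0) + card (Suc ` {j. j < n \<and> r = wp (alternating s t (Suc (2 * Suc j)))})"
    by (simp only:) (subst card_Un_disjoint, auto)
  also have "card (Suc ` {j. j < n \<and> r = wp (alternating s t (Suc (2 * Suc j)))}) =
      reflection_count (alternating t s n) (s \<otimes> r \<otimes> s)"
    using Suc.IH[of t s "s \<otimes> r \<otimes> s"] Suc.prems by (subst card_image) (auto simp: conj simp del: alternating.simps)
  finally show ?case by simp
qed simp

end

section \<open>Parity of reflection counts and the exchange condition\<close>

context coxeter_system
begin

lemma word_prod_relation: "s \<in> S \<Longrightarrow> t \<in> S \<Longrightarrow> wp (concat (replicate (ord (s \<otimes> t)) [s, t])) = \<one>"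
  by (simp add: concat_replicate_alternating word_prod_alternating_even pow_ord_eq_1)

text \<open>The reflections along the relator are \<open>(s \<otimes> t) [^] j \<otimes> s\<close>,
  which repeat in \<open>j\<close> with period \<open>ord (s \<otimes> t)\<close>; so each is met
  equally often in both halves.\<close>

lemma even_reflection_count_relation:
  assumes "s \<in> S" "t \<in> S" "r \<in> carrier W"
  shows "even (reflection_count (alternating s t (2 * ord (s \<otimes> t))) r)"
proof -
  let ?m = "ord (s \<otimes> t)"
  define P where "P j \<longleftrightarrow> r = (s \<otimes> t) [^] j \<otimes> s" for j :: nat
  have "wp (alternating s t (Suc (2 * j))) = (s \<otimes> t) [^] j \<otimes> s" for j
    using assms word_prod_append[of "alternating s t (2 * j)" "[s]"] alternating_snoc[of s t "2 * j"]
    by (simp add: word_prod_alternating_even del: alternating.simps)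
  then have P: "{j. j < 2 * ?m \<and> r = wp (alternating s t (Suc (2 * j)))} = {j. j < 2 * ?m \<and> P j}"
    by (simp add: P_def del: alternating.simps word_prod_Cons)
  have shift: "P (j + ?m) \<longleftrightarrow> P j" for j
    using assms by (simp add: P_def nat_pow_mult[symmetric] pow_ord_eq_1)
  have "{j. j < 2 * ?m \<and> P j} = {j. j < ?m \<and> P j} \<union> (\<lambda>j. j + ?m) ` {j. j < ?m \<and> P j}"
  proof safe
    fix j assume j: "j < 2 * ?m" "P j" "j \<notin> (\<lambda>j. j + ?m) ` {j. j < ?m \<and> P j}"
    show "j < ?m"
    proof (rule ccontr)
      assume "\<not> j < ?m"
      then have "j = (j - ?m) + ?m" "j - ?m < ?m" using j(1) by auto
      moreover from this have "P (j - ?m)" using shift[of "j - ?m"] j(2) by simp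
      ultimately show False using j(3) by blast
    qed
  qed (auto simp: shift)
  then have "card {j. j < 2 * ?m \<and> P j} = card {j. j < ?m \<and> P j} + card ((\<lambda>j. j + ?m) ` {j. j < ?m \<and> P j})"
    by (simp only:) (subst card_Un_disjoint, auto)
  also have "\<dots> = 2 * card {j. j < ?m \<and> P j}"
    by (subst card_image) (auto simp: inj_on_def)
  finally show ?thesis
    using assms by (simp add: reflection_count_alternating P del: alternating.simps word_prod_Cons)
qed

text \<open>An inserted relator has product \<open>\<one>\<close>, so it leaves the reflections of
  the later letters alone, and it contributes an even number itself.\<close>

lemma reflection_count_parity:
  "coxeter_cong W S us vs \<Longrightarrow> r \<in> carrier W \<Longrightarrow>
    even (reflection_count us r) \<longleftrightarrow> even (reflection_count vs r)"
proof (induction rule: coxeter_cong.induct)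
  case (rel us vs s t)
  let ?R = "concat (replicate (ord (s \<otimes> t)) [s, t])" and ?r = "inv (wp us) \<otimes> r \<otimes> wp us"
  have R: "?R \<in> lists S" using rel by (simp add: concat_replicate_alternating)
  have r: "?r \<in> carrier W" using rel by simp
  have "reflection_count (?R @ vs) ?r = reflection_count ?R ?r + reflection_count vs ?r"
    using R r rel by (simp add: reflection_count_append word_prod_relation)
  moreover have "even (reflection_count ?R ?r)"
    using even_reflection_count_relation r rel by (simp add: concat_replicate_alternating)
  ultimately show ?case
    using rel by (simp add: reflection_count_append)
qed auto

lemma length_parity: "coxeter_cong W S us vs \<Longrightarrow> even (length us) \<longleftrightarrow> even (length vs)"
  by (induction rule: coxeter_cong.induct) (auto simp: concat_replicate_alternating)

text \<open>A counted reflection is a letter conjugated by the prefix before it, so multiplication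
  by it deletes that letter.\<close>

lemma reflection_count_pos:
  "us \<in> lists S \<Longrightarrow> r \<in> carrier W \<Longrightarrow> reflection_count us r > 0 \<Longrightarrow>
    \<exists>p x q. us = p @ x # q \<and> r \<otimes> wp us = wp (p @ q)"
proof (induction us arbitrary: r)
  case (Cons s us)
  show ?case
  proof (cases "r = s")
    case True
    then show ?thesis using Cons.prems by (intro exI[of _ "[]"] exI[of _ s] exI[of _ us]) simp
  next
    case False
    then obtain p x q where "us = p @ x # q" and eq: "s \<otimes> r \<otimes> s \<otimes> wp us = wp (p @ q)"
      using Cons.IH[of "s \<otimes> r \<otimes> s"] Cons.prems by auto
    moreover have "r \<otimes> (s \<otimes> wp us) = s \<otimes> (s \<otimes> r \<otimes> s \<otimes> wp us)"
      using Cons.prems by (simp add: m_assoc)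
    ultimately show ?thesis
      by (intro exI[of _ "s # p"] exI[of _ x] exI[of _ q]) simp
  qed
qed simp

text \<open>In the reduced word \<open>y # ws\<close> the reflection \<open>y\<close> is counted
  once, since a further occurrence would give a shorter word for the same element. By parity it is
  counted in \<open>us\<close> as well, where it deletes a letter.\<close>

lemma exchange:
  assumes us: "us \<in> lists S" and ws: "is_reduced (y # ws)" and eq: "wp us = wp (y # ws)"
  shows "\<exists>p x q. us = p @ x # q \<and> wp (y # p @ q) = wp us"
proof -
  have y: "y \<in> S" "ws \<in> lists S" using reduced_lists[OF ws] by auto
  have "reflection_count ws y = 0"
  proof (rule ccontr)
    assume "reflection_count ws y \<noteq> 0"
    then obtain p x q where pq: "ws = p @ x # q" "y \<otimes> wp ws = wp (p @ q)"
      using reflection_count_pos[of ws y] y by auto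
    then have "length (y # ws) \<le> length (p @ q)"
      using y by (intro reduced_le[OF ws]) auto
    with pq(1) show False by simp
  qed
  then have "reflection_count (y # ws) y = 1" using y by simp
  moreover have "even (reflection_count us y) \<longleftrightarrow> even (reflection_count (y # ws) y)"
    using us y eq by (intro reflection_count_parity presentation) auto
  ultimately have "reflection_count us y > 0" by (auto intro: Nat.gr0I)
  then obtain p x q where pq: "us = p @ x # q" "y \<otimes> wp us = wp (p @ q)"
    using reflection_count_pos[of us y] us y by auto
  have "wp (y # p @ q) = wp us"
    using y us by (simp add: pq(2)[symmetric])
  with pq(1) show ?thesis by blast
qed

section \<open>Braid moves and Matsumoto's theorem\<close>

lemma word_prod_alternating_ord:
  assumes "s \<in> S" "t \<in> S"
  shows "wp (alternating s t (ord (s \<otimes> t))) = wp (alternating t s (ord (s \<otimes> t)))"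
proof -
  let ?m = "ord (s \<otimes> t)"
  let ?u = "if even ?m then alternating s t ?m else alternating t s ?m"
  have u: "?u \<in> lists S" "rev ?u = alternating t s ?m"
    using assms by (auto simp: rev_alternating)
  have "wp (alternating s t ?m) \<otimes> wp ?u = \<one>"
    using assms word_prod_append[OF alternating_lists[OF assms] u(1), of ?m] word_prod_alternating_even[OF assms, of ?m]
    by (simp only: alternating_add[symmetric] mult_2[symmetric]) (simp add: pow_ord_eq_1)
  then have "wp (alternating s t ?m) = inv (wp ?u)"
    using assms u(1) by (intro inv_equality[symmetric]) auto
  then show ?thesis using word_prod_rev[OF u(1), unfolded u(2)] by (simp only:)
qed

lemma ord_gen_commute: "s \<in> S \<Longrightarrow> t \<in> S \<Longrightarrow> ord (t \<otimes> s) = ord (s \<otimes> t)"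
  using ord_inv[of "s \<otimes> t"] by (simp add: inv_mult_group)

lemma reduced_no_repeat: "\<not> is_reduced (us @ c # c # vs)"
proof
  assume r: "is_reduced (us @ c # c # vs)"
  then have "us \<in> lists S" "c \<in> S" "vs \<in> lists S" using reduced_lists[OF r] by auto
  then have "length (us @ c # c # vs) \<le> length (us @ vs)"
    by (intro reduced_le[OF r]) (auto simp: word_prod_append)
  then show False by simp
qed

text \<open>Exchanging \<open>y\<close> into the word deletes one letter. This letter must lie
  beyond the alternating prefix, which therefore grows by \<open>y\<close> in front.\<close>

lemma alternating_extend:
  assumes x: "x \<in> S" "y \<in> S" and k: "0 < k" "k < ord (x \<otimes> y)"
    and A: "is_reduced (alternating x y k @ rest)"
    and B: "is_reduced (y # ws)" "wp (y # ws) = wp (alternating x y k @ rest)"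
  shows "\<exists>rest'. is_reduced (alternating y x (Suc k) @ rest') \<and>
    wp (alternating y x (Suc k) @ rest') = wp (alternating x y k @ rest)"
proof -
  let ?A = "alternating x y k @ rest"
  have rest: "rest \<in> lists S" using reduced_lists[OF A] by simp
  obtain p z q where pq: "?A = p @ z # q" and eq: "wp (y # p @ q) = wp ?A"
    using exchange[OF reduced_lists[OF A] B(1) B(2)[symmetric]] by blast
  have pS: "p \<in> lists S" "q \<in> lists S" using pq reduced_lists[OF A] by auto
  have len: "length ?A = Suc (length p + length q)" using pq by simp
  have red: "is_reduced (y # p @ q)"
    using pS x len by (intro reduced_transfer[OF A _ eq]) auto
  have "k \<le> length p"
  proof (rule ccontr)
    assume "\<not> k \<le> length p"
    then obtain i where k': "k = length p + Suc i" by (metis less_iff_Suc_add add_Suc_right not_le)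
    define j where "j = length p"
    define x' y' where "x' = (if even j then x else y)" and "y' = (if even j then y else x)"
    have "?A = alternating x y j @ alternating x' y' (Suc i) @ rest"
      using alternating_add[of x y j "Suc i"] by (simp add: k' j_def[symmetric] x'_def y'_def del: alternating.simps)
    with pq have p: "p = alternating x y j" and q: "z # q = alternating x' y' (Suc i) @ rest"
      by (simp_all add: append_eq_append_conv j_def del: alternating.simps)
    have yp: "y # p @ q = alternating y x j @ y' # q"
      using alternating_snoc[of y x j] by (simp add: p y'_def append_eq_append_conv2)
    show False
    proof (cases i)
      \<comment> \<open>Deleting the last letter of the prefix would equate the two alternating
        words of length \<open>k\<close>, although
        \<open>0 < k < ord (x \<otimes> y)\<close>.\<close>
      case 0
      then have "q = rest" "k = Suc j" using q k' by (auto simp: j_def)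
      then have "wp (alternating y x k @ rest) = wp (alternating x y k @ rest)"
        using eq p by simp
      then have "wp (alternating y x k) = wp (alternating x y k)"
        using x rest by (simp add: word_prod_append)
      then have "ord (x \<otimes> y) dvd k" using x alternating_eq_imp_ord_dvd[of x y k] by simp
      with k show False by (auto dest: dvd_imp_le)
    next
      \<comment> \<open>An earlier deletion would leave two equal adjacent letters.\<close>
      case (Suc i')
      then have "y # p @ q = alternating y x j @ y' # y' # alternating x' y' i' @ rest"
        unfolding yp using q by simp
      with red show False using reduced_no_repeat by metis
    qed
  qed
  then have "take k p = alternating x y k"
    using arg_cong[OF pq, of "take k"] by simp
  then have "p = alternating x y k @ drop k p"
    using append_take_drop_id[of k p] by simp
  then have "y # p @ q = alternating y x (Suc k) @ (drop k p @ q)" by simp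
  then show ?thesis using red eq by metis
qed

text \<open>If the words start with \<open>s \<noteq> t\<close>, repeated exchange produces a reduced word starting with an
  alternating word in \<open>s, t\<close> of full length \<open>ord (s \<otimes> t)\<close>. The induction hypothesis connects it, and
  its braid-transformed version, to the given words with the same first letter.\<close>

theorem matsumoto:
  fixes F :: "'g \<Rightarrow> 'x \<Rightarrow> 'x"
  assumes fin: "\<And>s t. s \<in> S \<Longrightarrow> t \<in> S \<Longrightarrow> 0 < ord (s \<otimes> t)"
    and closed: "\<And>s. s \<in> S \<Longrightarrow> F s \<in> X \<rightarrow> X"
    and braid: "\<And>s t x. s \<in> S \<Longrightarrow> t \<in> S \<Longrightarrow> s \<noteq> t \<Longrightarrow> x \<in> X \<Longrightarrow>
      foldr F (alternating s t (ord (s \<otimes> t))) x = foldr F (alternating t s (ord (s \<otimes> t))) x"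
  shows "is_reduced us \<Longrightarrow> is_reduced vs \<Longrightarrow> wp us = wp vs \<Longrightarrow> x \<in> X \<Longrightarrow> foldr F us x = foldr F vs x"
proof (induction "length us" arbitrary: us vs rule: less_induct)
  case less
  note us = less.prems(1) and vs = less.prems(2)
  have len: "length us = length vs"
    using reduced_le[OF us] reduced_le[OF vs] reduced_lists[OF us] reduced_lists[OF vs] less.prems(3)
    by (simp add: le_antisym)
  have same: "foldr F (c # p) x = foldr F (c # q) x"
    if "is_reduced (c # p)" "is_reduced (c # q)" "wp (c # p) = wp (c # q)" "length (c # p) = length us" for c p q
  proof -
    have "c \<in> S" "p \<in> lists S" "q \<in> lists S" using reduced_lists[OF that(1)] reduced_lists[OF that(2)] by auto
    then have "wp p = wp q" using that(3) by simp
    then have "foldr F p x = foldr F q x"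
      using that less.prems(4) reduced_Cons[OF that(1)] reduced_Cons[OF that(2)] by (intro less.hyps) auto
    then show ?thesis by simp
  qed
  show ?case
  proof (cases us)
    case Nil
    then show ?thesis using len by simp
  next
    case (Cons s us')
    then obtain t vs' where vs': "vs = t # vs'" using len by (cases vs) auto
    have st: "s \<in> S" "t \<in> S" using Cons vs' reduced_lists[OF us] reduced_lists[OF vs] by auto
    show ?thesis
    proof (cases "s = t")
      case True
      then show ?thesis using same[of s us' vs'] us vs Cons vs' less.prems(3) by simp
    next
      case False
      let ?m = "ord (s \<otimes> t)"
      have chain: "0 < k \<Longrightarrow> k \<le> ?m \<Longrightarrow> \<exists>y z rest. (y = s \<and> z = t \<or> y = t \<and> z = s) \<and>
        is_reduced (alternating y z k @ rest) \<and> wp (alternating y z k @ rest) = wp us" for k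
      proof (induction k)
        case (Suc k)
        show ?case
        proof (cases "k = 0")
          case True
          then show ?thesis using us Cons by (intro exI[of _ s] exI[of _ t] exI[of _ us']) simp
        next
          case False
          then have k: "0 < k" "k \<le> ?m" using Suc.prems by auto
          then obtain y z rest where yz: "y = s \<and> z = t \<or> y = t \<and> z = s"
            and red: "is_reduced (alternating y z k @ rest)" and wp: "wp (alternating y z k @ rest) = wp us"
            using Suc.IH[OF k] by blast
          have "\<exists>ws. is_reduced (z # ws) \<and> wp (z # ws) = wp us"
            using yz
          proof
            assume "y = s \<and> z = t"
            then show ?thesis using vs vs' less.prems(3) by (intro exI[of _ vs']) auto
          next
            assume "y = t \<and> z = s"
            then show ?thesis using us Cons by (intro exI[of _ us']) auto
          qed
          then obtain ws where ws: "is_reduced (z # ws)" "wp (z # ws) = wp us" by blast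
          have yzk: "y \<in> S" "z \<in> S" "k < ord (y \<otimes> z)"
            using yz st Suc.prems ord_gen_commute[OF st] by auto
          have "\<exists>rest'. is_reduced (alternating z y (Suc k) @ rest') \<and>
            wp (alternating z y (Suc k) @ rest') = wp (alternating y z k @ rest)"
            by (rule alternating_extend[OF yzk(1,2) k(1) yzk(3) red ws(1)]) (simp only: ws(2) wp)
          then obtain rest' where "is_reduced (alternating z y (Suc k) @ rest')"
            "wp (alternating z y (Suc k) @ rest') = wp us" using wp by auto
          then show ?thesis using yz by (intro exI[of _ z] exI[of _ y] exI[of _ rest']) blast
        qed
      qed simp
      obtain y z rest where yz: "y = s \<and> z = t \<or> y = t \<and> z = s"
        and A: "is_reduced (alternating y z ?m @ rest)" "wp (alternating y z ?m @ rest) = wp us"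
        using chain[OF fin[OF st] order_refl] by blast
      have S: "y \<in> S" "z \<in> S" "rest \<in> lists S" using yz st reduced_lists[OF A(1)] by auto
      have m: "ord (y \<otimes> z) = ?m" using yz ord_gen_commute[OF st] by auto
      have wpB: "wp (alternating z y ?m @ rest) = wp us"
        using word_prod_alternating_ord[OF S(1,2)] S A(2) by (simp add: word_prod_append m)
      have B: "is_reduced (alternating z y ?m @ rest)"
        using S by (intro reduced_transfer[OF A(1)]) (auto simp: wpB A(2))
      have rest: "foldr F rest x \<in> X"
        using S(3) less.prems(4) closed by (induction rest) auto
      have AB: "foldr F (alternating y z ?m @ rest) x = foldr F (alternating z y ?m @ rest) x"
        using braid[OF S(1,2) _ rest] yz False by (auto simp: m)
      obtain n where n: "?m = Suc n" using fin[OF st] by (cases ?m) auto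
      have lenA: "length (alternating y z ?m @ rest) = length us"
        using reduced_le[OF us] reduced_le[OF A(1)] reduced_lists[OF us] reduced_lists[OF A(1)] A(2)
        by (simp add: le_antisym del: length_append)
      have heads: "alternating y z ?m @ rest = y # alternating z y n @ rest"
        "alternating z y ?m @ rest = z # alternating y z n @ rest" by (simp_all add: n)
      have lenB: "length (alternating z y ?m @ rest) = length us" using lenA by simp
      note AB' = AB[unfolded heads] and A' = A[unfolded heads] and B' = B[unfolded heads] wpB[unfolded heads]
        and len' = lenA[unfolded heads] lenB[unfolded heads] and us' = us[unfolded Cons] and vs'' = vs[unfolded vs']
      have wp: "wp us = wp (s # us')" "wp us = wp (t # vs')"
        using less.prems(3) by (simp_all only: Cons vs')
      have "foldr F us x = foldr F vs x" if "y = s" "z = t"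
      proof -
        have "foldr F (s # alternating z y n @ rest) x = foldr F (s # us') x"
          by (rule same) (use A' len' us' wp that in \<open>simp_all only:\<close>)
        moreover have "foldr F (t # alternating y z n @ rest) x = foldr F (t # vs') x"
          by (rule same) (use B' len' vs'' wp that in \<open>simp_all only:\<close>)
        ultimately show ?thesis using AB' that by (simp only: Cons vs')
      qed
      moreover have "foldr F us x = foldr F vs x" if "y = t" "z = s"
      proof -
        have "foldr F (t # alternating z y n @ rest) x = foldr F (t # vs') x"
          by (rule same) (use A' len' vs'' wp that in \<open>simp_all only:\<close>)
        moreover have "foldr F (s # alternating y z n @ rest) x = foldr F (s # us') x"
          by (rule same) (use B' len' us' wp that in \<open>simp_all only:\<close>)
        ultimately show ?thesis using AB' that by (simp only: Cons vs')
      qed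
      ultimately show ?thesis using yz by blast
    qed
  qed
qed

text \<open>Some reduced word of \<open>w0\<close> ends in \<open>s\<close>; by Matsumoto's theorem
  it may replace \<open>us\<close>, and idempotence of \<open>F s\<close> then absorbs the extra
  factor.\<close>

corollary foldr_longest_absorb:
  fixes F :: "'g \<Rightarrow> 'x \<Rightarrow> 'x"
  assumes fin: "\<And>s t. s \<in> S \<Longrightarrow> t \<in> S \<Longrightarrow> 0 < ord (s \<otimes> t)"
    and closed: "\<And>s. s \<in> S \<Longrightarrow> F s \<in> X \<rightarrow> X"
    and braid: "\<And>s t x. s \<in> S \<Longrightarrow> t \<in> S \<Longrightarrow> s \<noteq> t \<Longrightarrow> x \<in> X \<Longrightarrow>
      foldr F (alternating s t (ord (s \<otimes> t))) x = foldr F (alternating t s (ord (s \<otimes> t))) x"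
    and idem: "\<And>s x. s \<in> S \<Longrightarrow> x \<in> X \<Longrightarrow> F s (F s x) = F s x"
    and w0: "longest_element W S w0" and us: "reduced_decomposition W S w0 us"
    and s: "s \<in> S" and x: "x \<in> X"
  shows "foldr F us (F s x) = foldr F us x"
proof -
  have usS: "us \<in> lists S" and wpus: "wp us = w0" and usr: "is_reduced us"
    and lus: "length us = cox_length W S w0"
    using us by (auto simp: reduced_decomposition_def)
  have w0c: "w0 \<in> carrier W" using w0 by (simp add: longest_element_def)
  obtain ws where ws: "reduced_decomposition W S (w0 \<otimes> s) ws"
    using reduced_decomposition_exists w0c s by (metis gen_closed m_closed)
  then have wsS: "ws \<in> lists S" and wpws: "wp ws = w0 \<otimes> s" and lws: "length ws \<le> length us"
    using w0 s lus by (auto simp: reduced_decomposition_def longest_element_def)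
  have eq: "wp (ws @ [s]) = wp us"
    using wsS s w0c by (simp add: word_prod_append wpws wpus m_assoc)
  \<comment> \<open>\<open>ws\<close> is not longer than \<open>us\<close>, and their lengths differ
    in parity, so it is strictly shorter.\<close>
  have "even (length (ws @ [s])) \<longleftrightarrow> even (length us)"
    using wsS s usS eq by (intro length_parity presentation) auto
  with lws have "length (ws @ [s]) \<le> length us" by (cases "length ws = length us") auto
  then have red: "is_reduced (ws @ [s])"
    using wsS s by (intro reduced_transfer[OF usr _ eq]) auto
  have Fx: "F s x \<in> X" using closed s x by auto
  have "foldr F us (F s x) = foldr F (ws @ [s]) (F s x)"
    by (rule matsumoto[OF fin closed braid usr red eq[symmetric] Fx])
  also have "\<dots> = foldr F (ws @ [s]) x" using idem s x by simp
  also have "\<dots> = foldr F us x"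
    by (rule matsumoto[OF fin closed braid red usr eq x])
  finally show ?thesis .
qed

end

section \<open>The action on a fibre\<close>

lemma foldr_alternating: "foldr F (alternating s t n) = alternate (F s) (F t) n"
  by (induction n arbitrary: s t) auto

lemma alternate_cong_on:
  assumes "f \<in> X \<rightarrow> X" "h \<in> X \<rightarrow> X" "\<And>x. x \<in> X \<Longrightarrow> f' x = f x" "\<And>x. x \<in> X \<Longrightarrow> h' x = h x"
  shows "x \<in> X \<Longrightarrow> alternate f' h' n x = alternate f h n x"
  using assms
proof (induction n arbitrary: f h f' h')
  case (Suc n)
  have "alternate h' f' n x = alternate h f n x"
    by (rule Suc.IH) (use Suc.prems in auto)
  moreover have "alternate h f n x \<in> X"
    using Suc.prems by (intro alternate_closed) auto
  ultimately show ?case using Suc.prems by simp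
qed simp

context coxeter_system
begin

lemma foldr_word_closed:
  assumes "\<And>s. s \<in> S \<Longrightarrow> R s \<in> X \<rightarrow> X" "us \<in> lists S" "x \<in> X"
  shows "foldr R us x \<in> X"
  using assms(2,3) assms(1) by (induction us) auto

lemma foldr_coxeter_cong:
  assumes closed: "\<And>s. s \<in> S \<Longrightarrow> R s \<in> X \<rightarrow> X"
    and relation: "\<And>s t x. s \<in> S \<Longrightarrow> t \<in> S \<Longrightarrow> x \<in> X \<Longrightarrow>
      foldr R (concat (replicate (ord (s \<otimes> t)) [s, t])) x = x"
  shows "coxeter_cong W S us vs \<Longrightarrow> x \<in> X \<Longrightarrow> foldr R us x = foldr R vs x"
proof (induction rule: coxeter_cong.induct)
  case (rel us vs s t)
  then have "foldr R vs x \<in> X" by (intro foldr_word_closed closed)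
  with rel show ?case by (simp add: relation)
qed auto

text \<open>By the presentation, two words for one element are linked by the relations, so every
  choice of word yields the same map on \<open>X\<close>; concatenation then gives
  multiplicativity.\<close>

lemma group_action_by_relations:
  fixes R :: "'g \<Rightarrow> 'x \<Rightarrow> 'x"
  assumes closed: "\<And>s. s \<in> S \<Longrightarrow> R s \<in> X \<rightarrow> X"
    and relation: "\<And>s t x. s \<in> S \<Longrightarrow> t \<in> S \<Longrightarrow> x \<in> X \<Longrightarrow>
      foldr R (concat (replicate (ord (s \<otimes> t)) [s, t])) x = x"
  shows "\<exists>A. group_action W X A \<and> (\<forall>s\<in>S. \<forall>x\<in>X. A s x = R s x)"
proof -
  define act where "act w = foldr R (SOME us. us \<in> lists S \<and> wp us = w)" for w
  have act: "act (wp us) x = foldr R us x" if "us \<in> lists S" "x \<in> X" for us x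
  proof -
    have "(SOME vs. vs \<in> lists S \<and> wp vs = wp us) \<in> lists S \<and>
        wp (SOME vs. vs \<in> lists S \<and> wp vs = wp us) = wp us"
      by (rule someI[of _ us]) (use that in simp)
    then show ?thesis
      unfolding act_def using that by (intro foldr_coxeter_cong[OF closed relation] presentation) auto
  qed
  have act_mult: "act (g \<otimes> h) x = act g (act h x)" and act_closed: "act g x \<in> X"
    if gh: "g \<in> carrier W" "h \<in> carrier W" and x: "x \<in> X" for g h x
  proof -
    obtain us vs where us: "us \<in> lists S" "wp us = g" and vs: "vs \<in> lists S" "wp vs = h"
      using word_prod_surj gh by metis
    have "foldr R vs x \<in> X" "foldr R us x \<in> X"
      using foldr_word_closed[OF closed vs(1) x] foldr_word_closed[OF closed us(1) x] by auto
    then show "act (g \<otimes> h) x = act g (act h x)" "act g x \<in> X"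
      using act[OF us(1)] act[OF vs(1) x] act[of "us @ vs" x] x us vs by (simp_all add: word_prod_append)
  qed
  have act_one: "act \<one> x = x" if "x \<in> X" for x
    using act[of "[]" x] that by simp
  have act_inv: "act (inv g) (act g x) = x" "act g (act (inv g) x) = x" if "g \<in> carrier W" "x \<in> X" for g x
    using act_mult[of "inv g" g x] act_mult[of g "inv g" x] act_one that by simp_all
  \<comment> \<open>\<open>Bij X\<close> consists of extensional bijections, hence the restriction
    to \<open>X\<close>.\<close>
  define A where "A w = restrict (act w) X" for w
  have bij: "A w \<in> Bij X" if w: "w \<in> carrier W" for w
  proof -
    have "bij_betw (act w) X X"
      by (rule bij_betw_byWitness[of _ "act (inv w)"]) (use w act_inv act_closed in auto)
    then show ?thesis by (simp add: Bij_def A_def)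
  qed
  have "group_action W X A"
    unfolding group_action_def
  proof (rule group_hom.intro)
    show "group W" by (rule is_group)
    show "group (BijGroup X)" by (rule group_BijGroup)
    show "group_hom_axioms W (BijGroup X) A"
    proof (unfold group_hom_axioms_def, rule homI)
      fix g h assume gh: "g \<in> carrier W" "h \<in> carrier W"
      have "A (g \<otimes> h) = compose X (A g) (A h)"
        using act_mult[OF gh] act_closed[OF gh(2,2)] by (auto simp: A_def compose_def restrict_def fun_eq_iff)
      then show "A (g \<otimes> h) = A g \<otimes>\<^bsub>BijGroup X\<^esub> A h"
        using bij gh by (simp add: BijGroup_def)
    qed (simp add: bij BijGroup_def)
  qed
  moreover have "A s x = R s x" if "s \<in> S" "x \<in> X" for s x
    using act[of "[s]" x] that by (simp add: A_def)
  ultimately show ?thesis by blast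
qed

end

section \<open>Invariance under rescaling of a root\<close>

context coroot
begin

context
  fixes l :: real assumes l: "0 < l"
begin

lemma coroot_scale: "coroot (l *\<^sub>R a) (\<lambda>v. av v / l) T"
  unfolding coroot_def using l T av_a bounded_linear_compose[OF bounded_linear_divide av] by (simp add: av.scale)

lemma pitman_scale:
  assumes "\<eta> \<in> paths0 T"
  shows "pitman T (l *\<^sub>R a) (\<lambda>v. av v / l) \<eta> = pitman T a av \<eta>"
proof (rule extend_path_inj[OF T])
  interpret l: coroot "l *\<^sub>R a" "\<lambda>v. av v / l" T by (rule coroot_scale)
  show "pitman T (l *\<^sub>R a) (\<lambda>v. av v / l) \<eta> \<in> paths0 T" "pitman T a av \<eta> \<in> paths0 T"
    by (intro l.pitman_paths0 pitman_paths0 assms)+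
  have "past_inf (\<lambda>s. av (extend_path T \<eta> s) / l) t = past_inf (\<lambda>s. av (extend_path T \<eta> s)) t / l" for t
    using past_inf_cmult[OF bdd_past_extend_path[OF assms], of "1 / l" t] l by simp
  then show "extend_path T (pitman T (l *\<^sub>R a) (\<lambda>v. av v / l) \<eta>) = extend_path T (pitman T a av \<eta>)"
    unfolding l.extend_path_pitman extend_path_pitman line_pitman_def using l by simp
qed

lemma simple_path_op_scale:
  assumes "\<eta> \<in> paths0 T"
  shows "simple_path_op T (l *\<^sub>R a) (\<lambda>v. av v / l) \<eta> = simple_path_op T a av \<eta>"
proof -
  interpret l: coroot "l *\<^sub>R a" "\<lambda>v. av v / l" T by (rule coroot_scale)
  show ?thesis
    using simple_path_op_paths0[OF assms] assms l by (intro l.simple_path_op_eqI) (auto simp: pitman_scale)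
qed

end

end

text \<open>Reflecting in \<open>a\<close> lowers \<open>av v + bv v\<close> by
  \<open>2 * av v * (1 - cos (pi / m))\<close>, whose last factor is positive. Maximising the sum
  over an orbit therefore leads to a dominant point.\<close>

lemma (in dihedral_roots) nonneg_if_maximal:
  assumes "av (v - av v *\<^sub>R a) + bv (v - av v *\<^sub>R a) \<le> av v + bv v"
  shows "0 \<le> av v"
proof -
  have "cos (pi / real m) < cos 0"
    using m by (intro cos_monotone_0_pi) (auto simp: field_simps)
  moreover have "0 \<le> av v * (1 - cos (pi / real m))"
    using assms by (simp add: av.diff bv.diff av.scale bv.scale av_a bv_a algebra_simps)
  ultimately show ?thesis by (simp add: zero_le_mult_iff)
qed

lemma (in dihedral_paths) relation_fixed_word:
  assumes R: "\<And>\<eta>. \<eta> \<in> paths0 T \<Longrightarrow> R s \<eta> = simple_path_op T a av \<eta>"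
    "\<And>\<eta>. \<eta> \<in> paths0 T \<Longrightarrow> R t \<eta> = simple_path_op T b bv \<eta>"
  shows "us \<in> lists {s, t} \<Longrightarrow> \<eta> \<in> paths0 T \<Longrightarrow> foldr R us \<eta> \<in> relation_fixed \<Longrightarrow> \<eta> \<in> relation_fixed"
proof (induction us)
  case (Cons c us)
  have S: "R s \<in> paths0 T \<rightarrow> paths0 T" "R t \<in> paths0 T \<rightarrow> paths0 T"
    using R a.simple_path_op_paths0 b.simple_path_op_paths0 by auto
  have "foldr R us \<eta> \<in> paths0 T"
    using Cons.prems(1,2) S by (induction us) auto
  then have "foldr R us \<eta> \<in> relation_fixed"
    using Cons.prems R by (intro relation_fixed_step) auto
  with Cons show ?case by simp
qed simp

section \<open>The relations in a finite Coxeter realization\<close>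

context finite_coxeter_realization
begin

lemma ord_gen_ge_2: "s \<in> S \<Longrightarrow> t \<in> S \<Longrightarrow> s \<noteq> t \<Longrightarrow> 2 \<le> ord (s \<otimes> t)"
  using gen_ord[of s t] ord_ge_1[OF finite_carrier, of "s \<otimes> t"] by simp

text \<open>The transforms do not change when the root is multiplied and the coroot divided by \<open>l > 0\<close>, so
  the two off-diagonal Cartan entries may be assumed equal.\<close>

lemma dihedral_roots_rescaled:
  assumes st: "s \<in> S" "t \<in> S" "s \<noteq> t"
  shows "\<exists>l>0. dihedral_roots (l *\<^sub>R \<alpha> s) (\<alpha> t) (\<lambda>v. \<alpha>v s v / l) (\<alpha>v t) (ord (s \<otimes> t))"
proof -
  let ?m = "ord (s \<otimes> t)"
  let ?c = "cos (pi / real ?m)"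
  interpret s: bounded_linear "\<alpha>v s" by (rule coroot_dual[OF st(1)])
  interpret t: bounded_linear "\<alpha>v t" by (rule coroot_dual[OF st(2)])
  have m: "2 \<le> ?m" by (rule ord_gen_ge_2[OF st])
  have D: "dihedral_roots (l *\<^sub>R \<alpha> s) (\<alpha> t) (\<lambda>v. \<alpha>v s v / l) (\<alpha>v t) ?m"
    if "0 < l" "\<alpha>v s (\<alpha> t) = - 2 * ?c * l" "l * \<alpha>v t (\<alpha> s) = - 2 * ?c" for l
    unfolding dihedral_roots_def
    using that m st coroot_root coroot_dual bounded_linear_compose[OF bounded_linear_divide coroot_dual[OF st(1)]]
    by (auto simp: s.scale t.scale)
  show ?thesis
  proof (cases "?m = 2")
    case True
    with D[of 1] commuting[OF st True] show ?thesis by (intro exI[of _ 1]) auto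
  next
    case False
    note nc = noncommuting[OF st False]
    have c: "0 < ?c"
      using m False by (intro cos_gt_zero) (auto simp: field_simps)
    \<comment> \<open>This \<open>l\<close> gives the first pairing the required value; the product
      condition on the Cartan entries then settles the second.\<close>
    define l where "l = - \<alpha>v s (\<alpha> t) / (2 * ?c)"
    have "0 < l" "\<alpha>v s (\<alpha> t) = - 2 * ?c * l" using c nc by (auto simp: l_def field_simps)
    moreover have "l * \<alpha>v t (\<alpha> s) = - 2 * ?c"
    proof -
      have "l * \<alpha>v t (\<alpha> s) = - (\<alpha>v s (\<alpha> t) * \<alpha>v t (\<alpha> s)) / (2 * ?c)" by (simp add: l_def)
      also have "\<dots> = - 2 * ?c" using nc c by (simp add: power2_eq_square)
      finally show ?thesis .
    qed
    ultimately show ?thesis using D[of l] by blast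
  qed
qed

lemma coroot_gen: "s \<in> S \<Longrightarrow> 0 < T \<Longrightarrow> coroot (\<alpha> s) (\<alpha>v s) T"
  using coroot_dual coroot_root by (simp add: coroot_def)

text \<open>Orbits under words of reflections inherit finiteness from \<open>W\<close> in this
  way.\<close>

lemma foldr_reflection:
  assumes "us \<in> lists S"
  shows "foldr (\<lambda>s v. v - \<alpha>v s v *\<^sub>R \<alpha> s) us v = \<rho> (wp us) v"
  using assms
proof (induction us)
  case Nil
  then show ?case using group_action.id_eq_one[OF action] by (metis foldr.simps(1) id_apply word_prod_Nil restrict_UNIV)
next
  case (Cons s us)
  then show ?case
    using group_action.composition_rule[OF action, of v s "wp us"] reflection[of s] by simp
qed

context
  fixes T :: real assumes T: "0 < T"
begin

abbreviation "P s \<equiv> pitman T (\<alpha> s) (\<alpha>v s)"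
abbreviation "R s \<equiv> simple_path_op T (\<alpha> s) (\<alpha>v s)"

lemma P_closed: "s \<in> S \<Longrightarrow> P s \<in> paths0 T \<rightarrow> paths0 T"
  using coroot.pitman_paths0[OF coroot_gen[OF _ T]] by auto

lemma R_closed: "s \<in> S \<Longrightarrow> R s \<in> paths0 T \<rightarrow> paths0 T"
  using coroot.simple_path_op_paths0[OF coroot_gen[OF _ T]] by auto

lemma P_braid:
  assumes st: "s \<in> S" "t \<in> S" "s \<noteq> t" and \<eta>: "\<eta> \<in> paths0 T"
  shows "foldr P (alternating s t (ord (s \<otimes> t))) \<eta> = foldr P (alternating t s (ord (s \<otimes> t))) \<eta>"
proof -
  obtain l where l: "0 < l" and D: "dihedral_roots (l *\<^sub>R \<alpha> s) (\<alpha> t) (\<lambda>v. \<alpha>v s v / l) (\<alpha>v t) (ord (s \<otimes> t))"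
    using dihedral_roots_rescaled[OF st] by blast
  interpret D: dihedral_paths "l *\<^sub>R \<alpha> s" "\<alpha> t" "\<lambda>v. \<alpha>v s v / l" "\<alpha>v t" "ord (s \<otimes> t)" T
    using D T by (simp add: dihedral_paths_def dihedral_paths_axioms_def)
  let ?P = "pitman T (l *\<^sub>R \<alpha> s) (\<lambda>v. \<alpha>v s v / l)"
  note P = P_closed[OF st(1)] P_closed[OF st(2)]
  have "?P \<eta> = P s \<eta>" if "\<eta> \<in> paths0 T" for \<eta>
    by (rule coroot.pitman_scale[OF coroot_gen[OF st(1) T] l that])
  then show ?thesis
    using D.pitman_braid[OF \<eta>] alternate_cong_on[OF P, of ?P "P t" \<eta>] alternate_cong_on[OF P(2,1), of "P t" ?P \<eta>] \<eta>
    by (simp add: foldr_alternating)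
qed

lemma foldr_R_endpoint:
  assumes "us \<in> lists S" "\<eta> \<in> paths0 T"
  shows "foldr R us \<eta> T = foldr (\<lambda>s v. v - \<alpha>v s v *\<^sub>R \<alpha> s) us (\<eta> T)"
  using assms
proof (induction us)
  case (Cons s us)
  then have "foldr R us \<eta> \<in> paths0 T" by (intro foldr_word_closed R_closed) auto
  then have "R s (foldr R us \<eta>) T = foldr R us \<eta> T - \<alpha>v s (foldr R us \<eta> T) *\<^sub>R \<alpha> s"
    using coroot.simple_path_op_paths0[OF coroot_gen[OF _ T], of s "foldr R us \<eta>"] Cons by auto
  then show ?case using Cons by simp
qed simp

text \<open>For distinct generators, a word of operators moves the endpoint into the dihedral
  dominant cone, where the relation is known; it is then carried back along the same word.\<close>

lemma R_relation:
  assumes st: "s \<in> S" "t \<in> S" and \<eta>: "\<eta> \<in> paths0 T"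
  shows "foldr R (concat (replicate (ord (s \<otimes> t)) [s, t])) \<eta> = \<eta>"
proof (cases "s = t")
  case True
  then have "ord (s \<otimes> t) = 1" using st by (simp add: ord_eq_1)
  with True show ?thesis
    using coroot.simple_path_op_involution[OF coroot_gen[OF st(1) T] \<eta>] by simp
next
  case False
  let ?r = "\<lambda>s v. v - \<alpha>v s v *\<^sub>R \<alpha> s" and ?v = "\<eta> T"
  obtain l where l: "0 < l" and D: "dihedral_roots (l *\<^sub>R \<alpha> s) (\<alpha> t) (\<lambda>v. \<alpha>v s v / l) (\<alpha>v t) (ord (s \<otimes> t))"
    using dihedral_roots_rescaled[OF st False] by blast
  interpret D: dihedral_paths "l *\<^sub>R \<alpha> s" "\<alpha> t" "\<lambda>v. \<alpha>v s v / l" "\<alpha>v t" "ord (s \<otimes> t)" T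
    using D T by (simp add: dihedral_paths_def dihedral_paths_axioms_def)
  interpret D': dihedral_roots "\<alpha> t" "l *\<^sub>R \<alpha> s" "\<alpha>v t" "\<lambda>v. \<alpha>v s v / l" "ord (s \<otimes> t)"
    by (rule D.swap)
  \<comment> \<open>The sum of the two coroots in the symmetric normalisation; on the finite orbit
    \<open>V\<close> it attains its maximum at a dominant vector.\<close>
  define \<phi> where "\<phi> v = \<alpha>v s v / l + \<alpha>v t v" for v
  define V where "V = (\<lambda>us. foldr ?r us ?v) ` lists {s, t}"
  have "V \<subseteq> (\<lambda>w. \<rho> w ?v) ` carrier W"
  proof
    fix v assume "v \<in> V"
    then obtain us where us: "us \<in> lists {s, t}" "v = foldr ?r us ?v" by (auto simp: V_def)
    then have "us \<in> lists S" using st by auto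
    with us show "v \<in> (\<lambda>w. \<rho> w ?v) ` carrier W" by (simp add: foldr_reflection)
  qed
  then have "finite V" using finite_carrier finite_surj by blast
  then have fin: "finite (\<phi> ` V)" and ne: "\<phi> ` V \<noteq> {}" by (auto simp: V_def)
  obtain v where v: "v \<in> V" "\<phi> v = Max (\<phi> ` V)" using Max_in[OF fin ne] by auto
  obtain us where us: "us \<in> lists {s, t}" "v = foldr ?r us ?v" using v(1) by (auto simp: V_def)
  have "?r c v \<in> V" if "c \<in> {s, t}" for c
    unfolding V_def using us that by (intro image_eqI[of _ _ "c # us"]) auto
  then have max: "\<phi> (?r c v) \<le> \<phi> v" if "c \<in> {s, t}" for c
    using that Max_ge[OF fin] v(2) by auto
  have usS: "us \<in> lists S" using us(1) st by auto
  have dom: "0 \<le> \<alpha>v s v / l" "0 \<le> \<alpha>v t v"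
    using D.nonneg_if_maximal[of v] D'.nonneg_if_maximal[of v] max[of s] max[of t] l
    by (simp_all add: \<phi>_def add.commute)
  have endpoint: "foldr R us \<eta> T = v" using foldr_R_endpoint[OF usS \<eta>] us(2) by simp
  have mem: "foldr R us \<eta> \<in> paths0 T" using usS \<eta> by (intro foldr_word_closed R_closed)
  have scale: "R s \<xi> = simple_path_op T (l *\<^sub>R \<alpha> s) (\<lambda>v. \<alpha>v s v / l) \<xi>" if "\<xi> \<in> paths0 T" for \<xi>
    using coroot.simple_path_op_scale[OF coroot_gen[OF st(1) T] l that] by simp
  have fixed: "foldr R us \<eta> \<in> D.relation_fixed"
    using D.relation_fixed_dominant[OF mem] dom by (simp add: endpoint)
  have "\<eta> \<in> D.relation_fixed"
    by (rule D.relation_fixed_word[where R = R and s = s and t = t, OF _ _ us(1) \<eta> fixed]) (simp_all add: scale)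
  then have "alternate (simple_path_op T (l *\<^sub>R \<alpha> s) (\<lambda>v. \<alpha>v s v / l)) (R t) (2 * ord (s \<otimes> t)) \<eta> = \<eta>"
    by (simp add: D.relation_fixed_def)
  moreover have "alternate (simple_path_op T (l *\<^sub>R \<alpha> s) (\<lambda>v. \<alpha>v s v / l)) (R t) (2 * ord (s \<otimes> t)) \<eta> =
      alternate (R s) (R t) (2 * ord (s \<otimes> t)) \<eta>"
    by (rule alternate_cong_on[OF R_closed[OF st(1)] R_closed[OF st(2)] _ _ \<eta>]) (auto simp: scale)
  ultimately show ?thesis
    by (simp add: concat_replicate_alternating foldr_alternating)
qed

lemma R_path_fibre:
  assumes "longest_element W S w0" "reduced_decomposition W S w0 us" "s \<in> S"
  shows "R s \<in> path_fibre \<alpha> \<alpha>v T us \<pi> \<rightarrow> path_fibre \<alpha> \<alpha>v T us \<pi>"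
proof
  fix \<eta> assume "\<eta> \<in> path_fibre \<alpha> \<alpha>v T us \<pi>"
  then have \<eta>: "\<eta> \<in> paths0 T" "foldr P us \<eta> = \<pi>"
    by (auto simp: path_fibre_def pitman_word_def)
  have absorb: "foldr P us (P s \<xi>) = foldr P us \<xi>" if "\<xi> \<in> paths0 T" for \<xi>
  proof (rule foldr_longest_absorb[OF _ P_closed P_braid _ assms that])
    show "0 < ord (s \<otimes> t)" if "s \<in> S" "t \<in> S" for s t
      using ord_ge_1[OF finite_carrier, of "s \<otimes> t"] that by simp
    show "P s (P s x) = P s x" if "s \<in> S" "x \<in> paths0 T" for s x
      by (rule coroot.pitman_idem[OF coroot_gen[OF that(1) T] that(2)])
  qed
  have R: "R s \<eta> \<in> paths0 T" "P s (R s \<eta>) = P s \<eta>"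
    using coroot.simple_path_op_paths0[OF coroot_gen[OF assms(3) T] \<eta>(1)] by auto
  \<comment> \<open>Both sides absorb a factor \<open>P s\<close>, and \<open>P s\<close> does not
    distinguish \<open>R s \<eta>\<close> from \<open>\<eta>\<close>.\<close>
  have "foldr P us (R s \<eta>) = foldr P us \<eta>"
    using absorb[OF R(1)] absorb[OF \<eta>(1)] R(2) by simp
  with R \<eta> show "R s \<eta> \<in> path_fibre \<alpha> \<alpha>v T us \<pi>"
    by (simp add: path_fibre_def pitman_word_def)
qed

end

end

theorem theorem4p16:
  fixes W :: "('g, 'b) monoid_scheme"
    and S :: "'g set"
    and \<alpha> :: "'g \<Rightarrow> 'v::real_normed_vector"
    and \<alpha>v :: "'g \<Rightarrow> 'v \<Rightarrow> real"
    and \<rho> :: "'g \<Rightarrow> 'v \<Rightarrow> 'v"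
    and w0 :: 'g and us :: "'g list"
    and T :: real and \<pi> :: "real \<Rightarrow> 'v"
  assumes "finite_coxeter_realization W S \<alpha> \<alpha>v \<rho>"
    and "longest_element W S w0"
    and "reduced_decomposition W S w0 us"
    and "T > 0"
    and "\<pi> \<in> dominant_paths0 S \<alpha>v T"
  shows "\<exists>A :: 'g \<Rightarrow> (real \<Rightarrow> 'v) \<Rightarrow> (real \<Rightarrow> 'v).
           group_action W (path_fibre \<alpha> \<alpha>v T us \<pi>) A \<and>
           (\<forall>s\<in>S. \<forall>\<eta>\<in>path_fibre \<alpha> \<alpha>v T us \<pi>.
              A s \<eta> = simple_path_op T (\<alpha> s) (\<alpha>v s) \<eta>)"
proof -
  interpret finite_coxeter_realization W S \<alpha> \<alpha>v \<rho> by (rule assms(1))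
  show ?thesis
  proof (rule group_action_by_relations)
    fix s assume "s \<in> S"
    then show "simple_path_op T (\<alpha> s) (\<alpha>v s) \<in> path_fibre \<alpha> \<alpha>v T us \<pi> \<rightarrow> path_fibre \<alpha> \<alpha>v T us \<pi>"
      by (rule R_path_fibre[OF assms(4,2,3)])
  next
    fix s t \<eta> assume "s \<in> S" "t \<in> S" "\<eta> \<in> path_fibre \<alpha> \<alpha>v T us \<pi>"
    then show "foldr (\<lambda>s. simple_path_op T (\<alpha> s) (\<alpha>v s))
        (concat (replicate (group.ord W (s \<otimes>\<^bsub>W\<^esub> t)) [s, t])) \<eta> = \<eta>"
      by (intro R_relation[OF assms(4)]) (auto simp: path_fibre_def)
  qed
qed

end
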